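(* There exists a constant $c>0$ such that for all sufficiently large $Q>0$ there exist a $2\times 2$ matrix weight $W=W_Q$ on $\mathbb{R}$ with $[W]_{\mathbf{A}_2}^{\mathrm{fat}}\le Q$ and a function $f\in L^2(W)$, $f:\mathbb{R}\to\mathbb{R}^2$, $f\neq 0$, such that $$\|\mathcal{H}f\|_{L^2(W)}\ \ge\ c\,Q^{3/2}\,\|f\|_{L^2(W)}.$$
   Context: A ($d$-dimensional, or $d\times d$) matrix weight on $\mathbb{R}$ is a locally integrable function $W$ on $\mathbb{R}$ with values in the set of (symmetric) positive definite $d\times d$ matrices. Here $d=2$. The weighted space $L^2(W)$ is the space of all measurable functions $f:\mathbb{R}\to\mathbb{R}^d$ with $\|f\|_{L^2(W)}^2:=\int_{\mathbb{R}}(W(x)f(x),f(x))\,dx<\infty$, where $(\cdot,\cdot)$ is the standard inner product of $\mathbb{R}^d$. As usual, functions equal almost everywhere are identified, and $f\ne0$ means that $f$ is not the zero element of $L^2(W)$. For a matrix weight $W$, write $W(x,t):=\frac1\pi\int_{\mathbb{R}}\frac{t}{(x-y)^2+t^2}W(y)\,dy$ for $x\in\mathbb{R}$, $t>0$ (the Poisson extension of $W$ to the upper half-plane), and let $W^{-1}(x,t)$ denote the Poisson extension, defined by the same formula, of the pointwise inverse function $y\mapsto W(y)^{-1}$. The "fattened" (Poisson) matrix $\mathbf{A}_2$ characteristic is $$[W]_{\mathbf{A}_2}^{\mathrm{fat}}:=\sup_{x\in\mathbb{R},\,t>0}\left\|W(x,t)^{1/2}\,W^{-1}(x,t)^{1/2}\right\|^2,$$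 where $\|\cdot\|$ is the operator norm of matrices; the bound $[W]_{\mathbf{A}_2}^{\mathrm{fat}}\le Q$ includes the assertion that it is finite. $\mathcal{H}$ is the Hilbert transform, $\mathcal{H}f(s)=\frac1\pi\,\mathrm{p.v.}\int_{\mathbb{R}}\frac{f(t)}{s-t}\,dt$, $s\in\mathbb{R}$, acting componentwise on $\mathbb{R}^2$-valued functions. *)

theory Defs
  imports "HOL-Analysis.Analysis"
begin

definition pos_def_matrix :: "real^'n^'n \<Rightarrow> bool" where
  "pos_def_matrix A \<longleftrightarrow> transpose A = A \<and> (\<forall>v. v \<noteq> 0 \<longrightarrow> 0 < (A *v v) \<bullet> v)"

definition pos_semidef_matrix :: "real^'n^'n \<Rightarrow> bool" where
  "pos_semidef_matrix A \<longleftrightarrow> transpose A = A \<and> (\<forall>v. 0 \<le> (A *v v) \<bullet> v)"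

(* Meaningful for positive semidefinite A, where the root exists and is unique. *)
definition matrix_sqrt :: "real^'n^'n \<Rightarrow> real^'n^'n" where
  "matrix_sqrt A = (THE B. pos_semidef_matrix B \<and> B ** B = A)"

definition matrix_weight :: "(real \<Rightarrow> real^'n^'n) \<Rightarrow> bool" where
  "matrix_weight W \<longleftrightarrow>
     (\<forall>K. compact K \<longrightarrow> W absolutely_integrable_on K) \<and> (\<forall>x. pos_def_matrix (W x))"

definition L2_weight_norm :: "(real \<Rightarrow> real^'n^'n) \<Rightarrow> (real \<Rightarrow> real^'n) \<Rightarrow> ennreal" where
  "L2_weight_norm W f =
     (let I = (\<integral>\<^sup>+ x. ennreal ((W x *v f x) \<bullet> f x) \<partial>lebesgue)
      in if I = \<infinity> then \<infinity> else ennreal (sqrt (enn2real I)))"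

definition in_L2_weight :: "(real \<Rightarrow> real^'n^'n) \<Rightarrow> (real \<Rightarrow> real^'n) \<Rightarrow> bool" where
  "in_L2_weight W f \<longleftrightarrow> f \<in> borel_measurable lebesgue \<and> L2_weight_norm W f < \<infinity>"

definition poisson_kernel :: "real \<Rightarrow> real \<Rightarrow> real \<Rightarrow> real" where
  "poisson_kernel x t y = t / ((x - y)\<^sup>2 + t\<^sup>2)"

definition poisson_integrable :: "(real \<Rightarrow> real^'n^'n) \<Rightarrow> real \<Rightarrow> real \<Rightarrow> bool" where
  "poisson_integrable W x t \<longleftrightarrow> integrable lebesgue (\<lambda>y. poisson_kernel x t y *\<^sub>R W y)"

definition poisson_ext :: "(real \<Rightarrow> real^'n^'n) \<Rightarrow> real \<Rightarrow> real \<Rightarrow> real^'n^'n" where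
  "poisson_ext W x t = (1 / pi) *\<^sub>R (\<integral> y. poisson_kernel x t y *\<^sub>R W y \<partial>lebesgue)"

(* The Bochner integral of a non-integrable function is 0, so divergence of either
   Poisson integral has to be turned into an infinite characteristic explicitly. *)
definition fat_A2_char :: "(real \<Rightarrow> real^'n^'n) \<Rightarrow> ennreal" where
  "fat_A2_char W =
     (let V = (\<lambda>y. matrix_inv (W y)) in
      SUP x. SUP t\<in>{0<..}.
        if poisson_integrable W x t \<and> poisson_integrable V x t
        then ennreal ((onorm (\<lambda>v. (matrix_sqrt (poisson_ext W x t) **
                                    matrix_sqrt (poisson_ext V x t)) *v v))\<^sup>2)
        else \<infinity>)"

definition hilbert_trunc :: "(real \<Rightarrow> real) \<Rightarrow> real \<Rightarrow> real \<Rightarrow> real" where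
  "hilbert_trunc f \<epsilon> s = (1 / pi) * (LINT t:{t. \<epsilon> < \<bar>s - t\<bar>}|lebesgue. f t / (s - t))"

(* The principal value at s exists: all truncated integrals converge absolutely and they
   have a finite limit.  Outside this domain the value of hilbert_transform is arbitrary. *)
definition hilbert_pv_exists :: "(real \<Rightarrow> real) \<Rightarrow> real \<Rightarrow> bool" where
  "hilbert_pv_exists f s \<longleftrightarrow>
     (\<forall>\<epsilon>>0. set_integrable lebesgue {t. \<epsilon> < \<bar>s - t\<bar>} (\<lambda>t. f t / (s - t))) \<and>
     (\<exists>l. ((\<lambda>\<epsilon>. hilbert_trunc f \<epsilon> s) \<longlongrightarrow> l) (at_right 0))"

definition hilbert_transform :: "(real \<Rightarrow> real) \<Rightarrow> real \<Rightarrow> real" where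
  "hilbert_transform f s = Lim (at_right 0) (\<lambda>\<epsilon>. hilbert_trunc f \<epsilon> s)"

definition hilbert_transform_vec :: "(real \<Rightarrow> real^'n) \<Rightarrow> real \<Rightarrow> real^'n" where
  "hilbert_transform_vec f s = (\<chi> i. hilbert_transform (\<lambda>t. f t $ i) s)"

end

theory Submission
  imports Defs "HOL-Probability.Sinc_Integral"
begin

text \<open>Let \<open>E\<close> be the \<open>n\<close>-th stage of the Cantor set in \<open>[0, 1]\<close> in which every interval has two
  children of relative length 1/8.  Let \<open>w\<close> be \<open>4\<^sup>n\<close> on \<open>E\<close> and \<open>4\<^sup>k / q\<close> on the part discarded
  at stage \<open>k\<close>, let \<open>g\<close> be the increasing step function on \<open>E\<close> whose oscillation decays by the factor
  1/4 per stage, and let \<open>W\<close> have the quadratic form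
  \<open>(u, v) \<mapsto> w (u + g v)\<^sup>2 + v\<^sup>2 / (q w)\<close>.

  At a point above a stage \<open>k\<close> interval, at a height comparable with its length, the Poisson
  extensions of \<open>w\<close>, \<open>1 / (q w)\<close> and \<open>w (g - \<gamma>)\<^sup>2\<close>, for the value \<open>\<gamma>\<close> of \<open>g\<close> expected on that
  interval, are bounded by multiples of \<open>4\<^sup>k\<close>, \<open>4\<^sup>-\<^sup>k\<close> and \<open>4\<^sup>-\<^sup>k\<close>, as long as \<open>n \<le> q\<close>; this bounds
  the trace of \<open>W(x,t) W\<^sup>-\<^sup>1(x,t)\<close> by a multiple of \<open>q\<close>.

  The function \<open>f = (- g, 1)\<close> on \<open>E\<close> is annihilated by the first square, so its norm is small,
  whereas for \<open>H f\<close> that square is the square of the commutator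
  \<open>\<integral>\<^sub>E (g(s) - g(t)) / (s - t) dt\<close>.  The integrand is nonnegative, as \<open>g\<close> increases on \<open>E\<close>, and of
  order \<open>2\<^sup>k\<close> on the sibling at stage \<open>k\<close>, which meets \<open>E\<close> in measure comparable to \<open>2\<^sup>-\<^sup>k 4\<^sup>-\<^sup>n\<close>; so each
  of the \<open>n\<close> stages contributes the same amount, and \<open>n\<close> may be as large as \<open>q\<close>.\<close>

section \<open>Poisson integrals of self-similar functions\<close>

lemma poisson_kernel_nonneg: "0 \<le> t \<Longrightarrow> 0 \<le> poisson_kernel x t y"
  by (simp add: poisson_kernel_def)

lemma borel_measurable_poisson_kernel [measurable]: "poisson_kernel x t \<in> borel_measurable borel"
  unfolding poisson_kernel_def by measurable

text \<open>The substitution \<open>u = (y - x) / t\<close> reduces the mass to the integral of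
  \<open>1 / (1 + u^2)\<close> over the line, which is \<open>pi\<close>.\<close>

lemma has_bochner_integral_poisson_kernel:
  assumes "0 < t"
  shows "has_bochner_integral lborel (poisson_kernel x t) pi"
proof -
  have "has_bochner_integral lborel (\<lambda>u::real. inverse (1 + u\<^sup>2)) pi"
    using LBINT_inverse_1_plus_square integrable_inverse_1_plus_square
    by (simp add: has_bochner_integral_iff interval_lebesgue_integral_def set_lebesgue_integral_def
        set_integrable_def)
  then have "has_bochner_integral lborel (\<lambda>y. inverse (1 + (-x/t + (1/t) * y)\<^sup>2)) (pi /\<^sub>R \<bar>1/t\<bar>)"
    using assms by (subst (asm) lborel_has_bochner_integral_real_affine_iff[where c="1/t" and t="-x/t"]) auto
  then have "has_bochner_integral lborel (\<lambda>y. inverse (1 + (-x/t + (1/t) * y)\<^sup>2) / t) (pi /\<^sub>R \<bar>1/t\<bar> / t)"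
    by (rule has_bochner_integral_divide_zero)
  moreover have "inverse (1 + (-x/t + (1/t) * y)\<^sup>2) / t = poisson_kernel x t y" for y
  proof -
    have "1 + (-x/t + (1/t) * y)\<^sup>2 = ((x-y)\<^sup>2 + t\<^sup>2) / t\<^sup>2"
      using assms by (simp add: field_simps power2_eq_square)
    then show ?thesis
      using assms by (simp add: poisson_kernel_def power2_eq_square)
  qed
  ultimately show ?thesis using assms by simp
qed

section \<open>Bounded Borel functions and their Poisson integrals\<close>

definition bounded_borel :: "(real \<Rightarrow> real) \<Rightarrow> bool" where
  "bounded_borel u \<longleftrightarrow> u \<in> borel_measurable borel \<and> (\<exists>B. \<forall>x. \<bar>u x\<bar> \<le> B)"

lemma bounded_borel_measurable [measurable_dest]: "bounded_borel u \<Longrightarrow> u \<in> borel_measurable borel"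
  by (simp add: bounded_borel_def)

lemma bounded_borelI: "u \<in> borel_measurable borel \<Longrightarrow> (\<And>x. \<bar>u x\<bar> \<le> B) \<Longrightarrow> bounded_borel u"
  by (auto simp: bounded_borel_def)

lemma bounded_borel_const [simp]: "bounded_borel (\<lambda>x. c)"
  by (auto simp: bounded_borel_def)

lemma bounded_borel_indicator [simp]: "A \<in> sets borel \<Longrightarrow> bounded_borel (indicator A)"
  by (auto simp: bounded_borel_def indicator_def intro!: exI[of _ 1])

lemma bounded_borel_add:
  assumes "bounded_borel u" "bounded_borel v"
  shows "bounded_borel (\<lambda>x. u x + v x)"
proof -
  obtain B B' where B: "\<And>x. \<bar>u x\<bar> \<le> B" "\<And>x. \<bar>v x\<bar> \<le> B'" using assms by (auto simp: bounded_borel_def)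
  have "\<bar>u x + v x\<bar> \<le> B + B'" for x
    using abs_triangle_ineq[of "u x" "v x"] B(1)[of x] B(2)[of x] by linarith
  then show ?thesis using assms by (intro bounded_borelI) (auto simp: bounded_borel_def)
qed

lemma bounded_borel_mult:
  assumes "bounded_borel u" "bounded_borel v"
  shows "bounded_borel (\<lambda>x. u x * v x)"
proof -
  obtain B B' where B: "\<And>x. \<bar>u x\<bar> \<le> B" "\<And>x. \<bar>v x\<bar> \<le> B'" using assms by (auto simp: bounded_borel_def)
  have "\<bar>u x * v x\<bar> \<le> B * B'" for x
    unfolding abs_mult using B order_trans[OF abs_ge_zero B(1)[of x]] by (intro mult_mono) auto
  then show ?thesis using assms by (intro bounded_borelI) (auto simp: bounded_borel_def)
qed

lemma bounded_borel_diff: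
  "bounded_borel u \<Longrightarrow> bounded_borel v \<Longrightarrow> bounded_borel (\<lambda>x. u x - v x)"
  using bounded_borel_add[of u "\<lambda>x. (- 1) * v x"] bounded_borel_mult[of "\<lambda>x. - 1" v] by simp

lemma bounded_borel_power2: "bounded_borel u \<Longrightarrow> bounded_borel (\<lambda>x. (u x)\<^sup>2)"
  using bounded_borel_mult[of u u] by (simp add: power2_eq_square)

lemmas bounded_borel_intros =
  bounded_borel_const bounded_borel_add bounded_borel_mult bounded_borel_diff bounded_borel_power2
  bounded_borel_indicator

text \<open>Scalar version without the factor \<open>1 / pi\<close> and over \<open>lborel\<close>,
  since all densities are Borel; \<open>poisson_sym2\<close> relates it to
  \<open>poisson_ext\<close>.\<close>

definition poisson_integral :: "(real \<Rightarrow> real) \<Rightarrow> real \<Rightarrow> real \<Rightarrow> real" where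
  "poisson_integral u x t = (\<integral>y. poisson_kernel x t y * u y \<partial>lborel)"

lemma integrable_mult_bounded_borel:
  fixes k :: "real \<Rightarrow> real"
  assumes "integrable lborel k" "bounded_borel u"
  shows "integrable lborel (\<lambda>y. k y * u y)"
proof -
  obtain B where B: "\<And>x. \<bar>u x\<bar> \<le> B" using assms by (auto simp: bounded_borel_def)
  show ?thesis
  proof (rule Bochner_Integration.integrable_bound)
    show "integrable lborel (\<lambda>y. k y * B)" using assms by simp
    show "(\<lambda>y. k y * u y) \<in> borel_measurable lborel" 
      using borel_measurable_integrable[OF assms(1)] assms(2) by (auto simp: bounded_borel_def)
    show "AE y in lborel. norm (k y * u y) \<le> norm (k y * B)"
    proof (rule AE_I2)
      show "norm (k y * u y) \<le> norm (k y * B)" for y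
        using mult_left_mono[OF order_trans[OF B[of y] abs_ge_self] abs_ge_zero[of "k y"]]
        by (simp add: abs_mult)
    qed
  qed
qed

lemma integrable_poisson:
  assumes "bounded_borel u" "0 < t"
  shows "integrable lborel (\<lambda>y. poisson_kernel x t y * u y)"
  using has_bochner_integral_poisson_kernel[OF assms(2), of x]
  by (intro integrable_mult_bounded_borel assms) (auto simp: has_bochner_integral_iff)

lemma poisson_integral_const: "0 < t \<Longrightarrow> poisson_integral (\<lambda>y. c) x t = pi * c"
  using has_bochner_integral_poisson_kernel[of t x]
  by (simp add: poisson_integral_def has_bochner_integral_iff)

lemma poisson_integral_add:
  "bounded_borel u \<Longrightarrow> bounded_borel v \<Longrightarrow> 0 < t \<Longrightarrow>
    poisson_integral (\<lambda>y. u y + v y) x t = poisson_integral u x t + poisson_integral v x t"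
  by (simp add: poisson_integral_def distrib_left integrable_poisson)

lemma poisson_integral_cmult: "poisson_integral (\<lambda>y. c * u y) x t = c * poisson_integral u x t"
  by (simp add: poisson_integral_def mult.left_commute)

lemma poisson_integral_mono:
  assumes "bounded_borel u" "bounded_borel v" "0 < t" "\<And>y. u y \<le> v y"
  shows "poisson_integral u x t \<le> poisson_integral v x t"
  unfolding poisson_integral_def using assms
  by (intro integral_mono integrable_poisson mult_left_mono) (auto simp: poisson_kernel_nonneg)

lemma poisson_integral_nonneg: "0 < t \<Longrightarrow> (\<And>y. 0 \<le> u y) \<Longrightarrow> 0 \<le> poisson_integral u x t"
  unfolding poisson_integral_def by (simp add: poisson_kernel_nonneg)

section \<open>Integrals over the unit interval and one self-similar step\<close>

lemma integrable_unit_interval: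
  "bounded_borel u \<Longrightarrow> integrable lborel (\<lambda>y. indicator {0..1::real} y * u y)"
  by (intro integrable_mult_bounded_borel) auto

definition unit_integral :: "(real \<Rightarrow> real) \<Rightarrow> real" where
  "unit_integral u = (\<integral>y. indicator {0..1} y * u y \<partial>lborel)"

lemma unit_integral_mono:
  assumes "bounded_borel u" "bounded_borel v" "\<And>y. u y \<le> v y"
  shows "unit_integral u \<le> unit_integral v"
  unfolding unit_integral_def
  by (intro integral_mono integrable_unit_interval assms mult_left_mono) (auto simp: assms)

lemma unit_integral_cmult: "unit_integral (\<lambda>y. c * u y) = c * unit_integral u"
  by (simp add: unit_integral_def mult.left_commute)

lemma unit_integral_const: "unit_integral (\<lambda>y. c) = c"
  by (simp add: unit_integral_def)

text \<open>One step of the self-similar construction: \<open>8 * x - 2\<close> and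
  \<open>8 * x - 5\<close> are the coordinates on the children \<open>[1/4, 3/8]\<close> and
  \<open>[5/8, 3/4]\<close>. The value \<open>d\<close> also fills the line outside the unit
  interval, so that a weight built by iteration can be positive everywhere.\<close>

definition graft :: "real \<Rightarrow> (real \<Rightarrow> real) \<Rightarrow> (real \<Rightarrow> real) \<Rightarrow> real \<Rightarrow> real" where
  "graft d u v x = (if 8 * x - 2 \<in> {0..1} then u (8 * x - 2)
     else if 8 * x - 5 \<in> {0..1} then v (8 * x - 5) else d)"

definition offspring :: "real set" where
  "offspring = {y. 8 * y - 2 \<in> {0..1} \<or> 8 * y - 5 \<in> {0..1}}"

lemma offspring_eq: "offspring = {1/4..3/8} \<union> {5/8..3/4}"
  by (auto simp: offspring_def)

lemma offspring_borel [measurable]: "offspring \<in> sets borel"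
  by (simp add: offspring_eq)

lemma graft_eq_sum:
  "graft d u v y = indicator {0..1} (8 * y - 2) * u (8 * y - 2)
     + indicator {0..1} (8 * y - 5) * v (8 * y - 5) + d * indicator (- offspring) y"
  by (auto simp: graft_def offspring_def indicator_def)

lemma bounded_borel_graft:
  assumes "bounded_borel u" "bounded_borel v"
  shows "bounded_borel (graft d u v)"
proof -
  obtain B B' where B: "\<And>x. \<bar>u x\<bar> \<le> B" "\<And>x. \<bar>v x\<bar> \<le> B'" using assms by (auto simp: bounded_borel_def)
  have [measurable]: "u \<in> borel_measurable borel" "v \<in> borel_measurable borel"
    using assms by (auto simp: bounded_borel_def)
  have "graft d u v \<in> borel_measurable borel"
    unfolding graft_def by measurable
  moreover have "\<bar>graft d u v x\<bar> \<le> max B (max B' \<bar>d\<bar>)" for x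
    using B by (simp add: graft_def le_max_iff_disj)
  ultimately show ?thesis by (rule bounded_borelI)
qed

lemma minus_add_eq_diff: "- c + 8 * y = 8 * y - (c::real)"
  by simp

lemma integrable_child:
  fixes F :: "real \<Rightarrow> real"
  assumes "integrable lborel (\<lambda>y. indicator {0..1} y * F y)"
  shows "integrable lborel (\<lambda>y. indicator {0..1} (8 * y - c) * F (8 * y - c))"
  using lborel_integrable_real_affine[OF assms, of 8 "-c"] unfolding minus_add_eq_diff by simp

lemma integral_child:
  fixes F :: "real \<Rightarrow> real"
  shows "(\<integral>y. indicator {0..1} (8 * y - c) * F (8 * y - c) \<partial>lborel)
    = (1/8) * (\<integral>y. indicator {0..1} y * F y \<partial>lborel)"
  using lborel_integral_real_affine[of 8 "\<lambda>y. indicator {0..1} y * F y" "-c"] unfolding minus_add_eq_diff by simp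

text \<open>The kernel is homogeneous of degree -1, so child coordinates multiply the height by 8;
  the factor 8 in front cancels the Jacobian in \<open>poisson_integral_child\<close>.\<close>

lemma poisson_kernel_child:
  "poisson_kernel x t y = 8 * poisson_kernel (8 * x - c) (8 * t) (8 * y - c)"
proof -
  have "(8 * x - c - (8 * y - c))\<^sup>2 + (8 * t)\<^sup>2 = 64 * ((x - y)\<^sup>2 + t\<^sup>2)"
    by (simp add: power2_eq_square algebra_simps)
  moreover have "t / D = 8 * (8 * t / (64 * D))" for D
    by simp
  ultimately show ?thesis unfolding poisson_kernel_def by metis
qed

lemma poisson_integral_child:
  "poisson_integral (\<lambda>y. indicator {0..1} (8 * y - c) * u (8 * y - c)) x t
    = poisson_integral (\<lambda>y. indicator {0..1} y * u y) (8 * x - c) (8 * t)"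
proof -
  have *: "poisson_kernel x t y * (indicator {0..1} (8 * y - c) * u (8 * y - c)) =
    8 * (indicator {0..1} (8 * y - c) * (poisson_kernel (8 * x - c) (8 * t) (8 * y - c) * u (8 * y - c)))" for y
    by (subst poisson_kernel_child[of _ _ _ c]) (simp add: mult_ac)
  show ?thesis
    unfolding poisson_integral_def *
    using integral_child[of c "\<lambda>y. poisson_kernel (8 * x - c) (8 * t) y * u y"]
    by (simp add: mult.left_commute)
qed

lemma bounded_borel_child:
  assumes "bounded_borel u"
  shows "bounded_borel (\<lambda>y. indicator {0..1} (8 * y - c) * u (8 * y - c))"
proof -
  obtain B where B: "\<And>x. \<bar>u x\<bar> \<le> B" using assms by (auto simp: bounded_borel_def)
  have [measurable]: "u \<in> borel_measurable borel"
    using assms by (auto simp: bounded_borel_def)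
  show ?thesis
  proof (rule bounded_borelI)
    show "\<bar>indicator {0..1} (8 * y - c) * u (8 * y - c)\<bar> \<le> B" for y
      using B[of "8*y-c"] by (auto simp: indicator_def)
  qed measurable
qed

lemma poisson_integral_graft:
  assumes "bounded_borel u" "bounded_borel v" "0 < t"
  shows "poisson_integral (graft d u v) x t =
    poisson_integral (\<lambda>y. indicator {0..1} y * u y) (8 * x - 2) (8 * t)
    + poisson_integral (\<lambda>y. indicator {0..1} y * v y) (8 * x - 5) (8 * t)
    + d * poisson_integral (indicator (- offspring)) x t"
  unfolding graft_eq_sum
  by (simp add: poisson_integral_add poisson_integral_cmult poisson_integral_child assms
      bounded_borel_intros bounded_borel_child)

text \<open>Each child has length 1/8, which leaves 3/4 of the unit interval to the density
  \<open>d\<close>.\<close>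

lemma unit_integral_graft:
  assumes "bounded_borel u" "bounded_borel v"
  shows "unit_integral (graft d u v) = (unit_integral u + unit_integral v) / 8 + 3/4 * d"
proof -
  have *: "indicator {0..1} y * graft d u v y = indicator {0..1} (8 * y - 2) * u (8 * y - 2)
     + indicator {0..1} (8 * y - 5) * v (8 * y - 5) + d * indicator ({0..1} - offspring) y" for y
    by (auto simp: graft_def offspring_def indicator_def)
  have "emeasure lborel offspring \<le> emeasure lborel {0..1::real}"
    by (rule emeasure_mono) (auto simp: offspring_eq)
  then have "measure lborel ({0..1} - offspring) = measure lborel {0..1::real} - measure lborel offspring"
    by (intro measure_Diff) (auto simp: offspring_eq top_unique)
  also have "measure lborel offspring = 1/4"
    unfolding offspring_eq by (subst measure_Un_AE) (auto intro!: AE_I2 fmeasurableI)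
  finally have m: "measure lborel ({0..1} - offspring) = 3/4" by simp
  have fin: "emeasure lborel ({0..1} - offspring) < \<infinity>"
    by (rule order.strict_trans1[OF emeasure_mono[of _ "{0..1}"]]) auto
  have i: "integrable lborel (indicator ({0..1} - offspring) :: real \<Rightarrow> real)"
    using fin by (intro integrable_real_indicator) auto
  show ?thesis
    unfolding unit_integral_def * using i
    by (simp add: integrable_child integrable_unit_interval assms integral_child m add_divide_distrib)
qed

section \<open>Upper bounds for Poisson integrals far from and near the children\<close>

lemma graft_off: "y \<notin> {1/4..3/4} \<Longrightarrow> graft d u v y = d"
  by (auto simp: graft_def)

lemma graft_all:
  "P d \<Longrightarrow> (\<And>y. P (u y)) \<Longrightarrow> (\<And>y. P (v y)) \<Longrightarrow> P (graft d u v x)"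
  by (simp add: graft_def)

lemma indicator_mult_le: "0 \<le> (a::real) \<Longrightarrow> indicator A y * a \<le> a"
  by (simp add: indicator_def)

text \<open>At such a point the kernel is at most 4 on the middle half, where \<open>u\<close> is
  controlled only through its unit integral. Elsewhere \<open>u\<close> is at most \<open>B\<close>,
  and the whole mass \<open>pi\<close> of the kernel is allowed. The sum
  \<open>pi * B + 4 * B\<close> is below \<open>8 * B\<close>.\<close>

lemma poisson_integral_far:
  assumes u: "bounded_borel u" "\<And>y. 0 \<le> u y" "\<And>y. y \<notin> {1/4..3/4} \<Longrightarrow> u y \<le> B" "unit_integral u \<le> B"
    and t: "0 < t" "x \<notin> {1/8..7/8} \<or> 1 \<le> t"
  shows "poisson_integral u x t \<le> 8 * B"
proof -
  have B: "0 \<le> B" using u(2)[of 2] u(3)[of 2] by simp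
  have k4: "poisson_kernel x t y \<le> 4" if "y \<in> {1/4..3/4}" for y
  proof -
    have *: "t \<le> 4 * ((x - y)\<^sup>2 + t\<^sup>2)"
    proof (cases "1 \<le> t")
      case True
      then have h: "t \<le> t\<^sup>2" by (simp add: power2_eq_square)
      have "t \<le> 4 * (a + b)" if "t \<le> b" "0 \<le> a" "0 \<le> b" for a b
        using that by simp
      from this[OF h] show ?thesis by simp
    next
      case False
      then have "1/8 \<le> \<bar>x - y\<bar>" using t(2) that by auto
      then have "(1/8)\<^sup>2 \<le> (x - y)\<^sup>2" by (simp add: abs_le_square_iff[symmetric])
      moreover have "t \<le> 4 * ((1/8)\<^sup>2 + t\<^sup>2)"
        using zero_le_power2[of "2 * t - 1/4"] by (simp add: power2_eq_square algebra_simps)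
      ultimately show ?thesis unfolding distrib_left by linarith
    qed
    have "0 < (x - y)\<^sup>2 + t\<^sup>2" using t by (simp add: add_nonneg_pos)
    then show ?thesis using * by (simp add: poisson_kernel_def divide_le_eq)
  qed
  have pw: "poisson_kernel x t y * u y \<le> poisson_kernel x t y * B + 4 * (indicator {0..1} y * u y)" for y
  proof (cases "y \<in> {1/4..3/4}")
    case True
    then have "poisson_kernel x t y * u y \<le> 4 * u y" using k4 u by (intro mult_right_mono) auto
    moreover have "indicator {0..1} y = (1::real)" using True by auto
    moreover have "0 \<le> poisson_kernel x t y * B" using t B by (simp add: poisson_kernel_nonneg)
    ultimately show ?thesis by simp
  next
    case False
    then have "poisson_kernel x t y * u y \<le> poisson_kernel x t y * B"
      using u t by (intro mult_left_mono poisson_kernel_nonneg) auto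
    moreover have "0 \<le> indicator {0..1} y * u y" using u by simp
    ultimately show ?thesis by simp
  qed
  have "poisson_integral u x t \<le> (\<integral>y. poisson_kernel x t y * B + 4 * (indicator {0..1} y * u y) \<partial>lborel)"
    unfolding poisson_integral_def
    by (intro integral_mono pw integrable_poisson u Bochner_Integration.integrable_add t
        integrable_mult_right integrable_unit_interval bounded_borel_const)
  also have "\<dots> = pi * B + 4 * unit_integral u"
    using Bochner_Integration.integral_add[OF
        integrable_poisson[OF bounded_borel_const t(1), of x B]
        integrable_mult_right[OF integrable_unit_interval[OF u(1)], of 4]]
      poisson_integral_const[OF t(1), of B x]
    by (simp only: poisson_integral_def unit_integral_def integral_mult_right_zero)
  also have "\<dots> \<le> 8 * B"
    using mult_right_mono[OF less_imp_le[OF pi_less_4] B] u(4) by simp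
  finally show ?thesis .
qed

text \<open>The far bound is applied to both children in their own coordinates, and the density
  \<open>d\<close> contributes at most \<open>pi * d\<close>.\<close>

lemma poisson_integral_graft_far:
  assumes u: "bounded_borel u" "\<And>y. 0 \<le> u y" "\<And>y. y \<notin> {1/4..3/4} \<Longrightarrow> u y \<le> B" "unit_integral u \<le> B"
    and v: "bounded_borel v" "\<And>y. 0 \<le> v y" "\<And>y. y \<notin> {1/4..3/4} \<Longrightarrow> v y \<le> B" "unit_integral v \<le> B"
    and t: "0 < t" "8 * x - 2 \<notin> {1/8..7/8} \<or> 1 \<le> 8 * t" "8 * x - 5 \<notin> {1/8..7/8} \<or> 1 \<le> 8 * t"
    and d: "0 \<le> d"
  shows "poisson_integral (graft d u v) x t \<le> 16 * B + 4 * d"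
proof -
  have 1: "poisson_integral (\<lambda>y. indicator {0..1} y * u y) (8 * x - 2) (8 * t) \<le> 8 * B"
    by (rule order_trans[OF poisson_integral_mono poisson_integral_far[OF u _ t(2)]])
       (use t u in \<open>auto intro!: bounded_borel_intros indicator_mult_le\<close>)
  have 2: "poisson_integral (\<lambda>y. indicator {0..1} y * v y) (8 * x - 5) (8 * t) \<le> 8 * B"
    by (rule order_trans[OF poisson_integral_mono poisson_integral_far[OF v _ t(3)]])
       (use t v in \<open>auto intro!: bounded_borel_intros indicator_mult_le\<close>)
  have "poisson_integral (indicator (- offspring)) x t \<le> poisson_integral (\<lambda>y. 1) x t"
    by (intro poisson_integral_mono) (use t in \<open>auto intro!: bounded_borel_intros simp: indicator_def\<close>)
  also have "\<dots> \<le> 4" using pi_less_4 t by (simp add: poisson_integral_const)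
  finally have "d * poisson_integral (indicator (- offspring)) x t \<le> d * 4"
    by (rule mult_left_mono[OF _ d])
  then show ?thesis using 1 2 by (simp add: poisson_integral_graft u v t)
qed

text \<open>Meant for the sibling: a point over the middle of one child has, in the coordinates of
  the other, distance at least 2 from the unit interval, where the kernel is at most
  \<open>t / 4\<close>.\<close>

lemma poisson_integral_separated:
  assumes v: "bounded_borel v" "\<And>y. 0 \<le> v y" and t: "0 < t" and x: "\<And>y. y \<in> {0..1} \<Longrightarrow> 2 \<le> \<bar>x - y\<bar>"
  shows "poisson_integral (\<lambda>y. indicator {0..1} y * v y) x t \<le> t * unit_integral v / 4"
proof -
  have "poisson_kernel x t y * (indicator {0..1} y * v y) \<le> t/4 * (indicator {0..1} y * v y)" for y
  proof (cases "y \<in> {0..1}")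
    case True
    then have "2\<^sup>2 \<le> (x - y)\<^sup>2" using x[of y] abs_le_square_iff[of 2 "x - y"] by simp
    then have "poisson_kernel x t y \<le> t / 4"
      unfolding poisson_kernel_def using t by (intro divide_left_mono) (auto intro!: add_nonneg_pos mult_pos_pos add_increasing2)
    then show ?thesis using v by (intro mult_right_mono) auto
  qed simp
  then have "poisson_integral (\<lambda>y. indicator {0..1} y * v y) x t \<le> (\<integral>y. t/4 * (indicator {0..1} y * v y) \<partial>lborel)"
    unfolding poisson_integral_def
    by (intro integral_mono integrable_poisson v t integrable_mult_right integrable_unit_interval
        bounded_borel_mult bounded_borel_indicator) auto
  also have "\<dots> = t * unit_integral v / 4"
    by (simp add: unit_integral_def)
  finally show ?thesis .
qed

text \<open>Over the middle of a child the complement of both children is at distance at least 1/64.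
  There the kernel at height \<open>t\<close> is at most \<open>128 * t\<close> times the kernel at
  the fixed height 1/64, so the bound is linear in \<open>t\<close>.\<close>

lemma poisson_integral_off_offspring:
  assumes t: "0 < t" and x: "8 * x - 2 \<in> {1/8..7/8} \<or> 8 * x - 5 \<in> {1/8..7/8}"
  shows "poisson_integral (indicator (- offspring)) x t \<le> 512 * t"
proof -
  have "poisson_kernel x t y * indicator (- offspring) y \<le> (128 * t) * (poisson_kernel x (1/64) y * 1)" for y
  proof (cases "y \<in> offspring")
    case True
    then show ?thesis using t by (simp add: poisson_kernel_nonneg)
  next
    case False
    then have "1/64 \<le> \<bar>x - y\<bar>" using x by (auto simp: offspring_def)
    then have s: "(1/64)\<^sup>2 \<le> (x - y)\<^sup>2" by (simp add: abs_le_square_iff[symmetric])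
    then have p: "0 < (x - y)\<^sup>2 + t\<^sup>2" "0 < (x - y)\<^sup>2 + (1/64)\<^sup>2" using t by (auto intro: add_nonneg_pos)
    have "a + e \<le> 2 * (a + b)" if "e \<le> a" "0 \<le> b" for a b e :: real
      using that by simp
    from this[OF s] have "(x - y)\<^sup>2 + (1/64)\<^sup>2 \<le> 2 * ((x - y)\<^sup>2 + t\<^sup>2)" by simp
    then have "t * ((x - y)\<^sup>2 + (1/64)\<^sup>2) \<le> 2 * t * ((x - y)\<^sup>2 + t\<^sup>2)"
      using t mult_left_mono[of _ _ t] by (metis less_imp_le mult.assoc mult.left_commute)
    then have "t / ((x - y)\<^sup>2 + t\<^sup>2) \<le> 2 * t / ((x - y)\<^sup>2 + (1/64)\<^sup>2)"
      using p by (simp add: frac_le_eq divide_le_eq le_divide_eq mult.commute)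
    moreover have "(128 * t) * ((1/64) / D) = 2 * t / D" for D by simp
    moreover have "indicator (- offspring) y = (1::real)" using False by simp
    ultimately show ?thesis by (simp only: poisson_kernel_def mult_1_right)
  qed
  then have "poisson_integral (indicator (- offspring)) x t
      \<le> (\<integral>y. (128 * t) * (poisson_kernel x (1/64) y * 1) \<partial>lborel)"
    unfolding poisson_integral_def
    by (intro integral_mono integrable_poisson t integrable_mult_right bounded_borel_intros) auto
  also have "\<dots> = 128 * t * pi"
    using poisson_integral_const[of "1/64" 1 x] by (simp add: poisson_integral_def)
  also have "\<dots> \<le> 512 * t" using t mult_left_mono[OF less_imp_le[OF pi_less_4], of "128 * t"] by simp
  finally show ?thesis .
qed

text \<open>The contribution of the child below the point is enlarged to a Poisson integral over the
  whole line in child coordinates, which prepares the iteration; the sibling and the density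
  \<open>d\<close> cost only a multiple of \<open>t\<close>.\<close>

lemma poisson_integral_graft_near:
  assumes u: "bounded_borel u" "\<And>y. 0 \<le> u y" and v: "bounded_borel v" "\<And>y. 0 \<le> v y"
    and t: "0 < t" and d: "0 \<le> d"
  shows "8 * x - 2 \<in> {1/8..7/8} \<Longrightarrow> poisson_integral (graft d u v) x t
      \<le> poisson_integral u (8 * x - 2) (8 * t) + t * (2 * unit_integral v + 512 * d)" (is "?P \<Longrightarrow> ?A")
    and "8 * x - 5 \<in> {1/8..7/8} \<Longrightarrow> poisson_integral (graft d u v) x t
      \<le> poisson_integral v (8 * x - 5) (8 * t) + t * (2 * unit_integral u + 512 * d)" (is "?Q \<Longrightarrow> ?B")
proof -
  have r: "d * poisson_integral (indicator (- offspring)) x t \<le> d * (512 * t)" if "?P \<or> ?Q"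
    by (rule mult_left_mono[OF poisson_integral_off_offspring[OF t that] d])
  have restrict: "poisson_integral (\<lambda>y. indicator {0..1} y * w y) x' (8 * t) \<le> poisson_integral w x' (8 * t)"
    if "bounded_borel w" "\<And>y. 0 \<le> w y" for w x'
    using that t by (intro poisson_integral_mono) (auto intro!: bounded_borel_intros indicator_mult_le)
  show ?A if ?P
  proof -
    have "poisson_integral (\<lambda>y. indicator {0..1} y * v y) (8 * x - 5) (8 * t) \<le> (8 * t) * unit_integral v / 4"
      by (rule poisson_integral_separated) (use v t that in auto)
    then show ?thesis using r that restrict[OF u, of "8 * x - 2"]
      by (simp add: poisson_integral_graft u v t algebra_simps)
  qed
  show ?B if ?Q
  proof -
    have "poisson_integral (\<lambda>y. indicator {0..1} y * u y) (8 * x - 2) (8 * t) \<le> (8 * t) * unit_integral u / 4"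
      by (rule poisson_integral_separated) (use u t that in auto)
    then show ?thesis using r that restrict[OF v, of "8 * x - 5"]
      by (simp add: poisson_integral_graft u v t algebra_simps)
  qed
qed

section \<open>The Cantor weight\<close>

primrec cantor_weight :: "real \<Rightarrow> nat \<Rightarrow> real \<Rightarrow> real" where
  "cantor_weight q 0 = (\<lambda>x. 1)"
| "cantor_weight q (Suc n) = graft (1/q) (\<lambda>y. 4 * cantor_weight q n y) (\<lambda>y. 4 * cantor_weight q n y)"

primrec cantor_shear :: "nat \<Rightarrow> real \<Rightarrow> real" where
  "cantor_shear 0 = (\<lambda>x. 0)"
| "cantor_shear (Suc n) = graft 0 (\<lambda>y. cantor_shear n y / 4 - 1/2) (\<lambda>y. cantor_shear n y / 4 + 1/2)"

text \<open>The bound 2/3 is the fixed point of \<open>z = z / 4 + 1/2\<close>.\<close>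

lemma abs_cantor_shear_le: "\<bar>cantor_shear n x\<bar> \<le> 2/3"
proof (induction n arbitrary: x)
  case (Suc n)
  have "\<bar>cantor_shear n y / 4 - 1/2\<bar> \<le> 2/3" "\<bar>cantor_shear n y / 4 + 1/2\<bar> \<le> 2/3" for y
    using Suc[of y] unfolding abs_le_iff by linarith+
  then show ?case
    unfolding cantor_shear.simps by (intro graft_all[where P = "\<lambda>z. \<bar>z\<bar> \<le> 2/3"]) auto
qed simp

lemma cantor_weight_ge: "1 \<le> q \<Longrightarrow> 1/q \<le> cantor_weight q n x"
proof (induction n arbitrary: x)
  case (Suc n)
  have "0 \<le> 1/q" using Suc.prems by simp
  then have "1/q \<le> 4 * cantor_weight q n y" for y
    using Suc.IH[OF Suc.prems, of y] by linarith
  then show ?case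
    unfolding cantor_weight.simps by (intro graft_all[where P = "\<lambda>z. 1/q \<le> z"]) auto
qed simp

lemma cantor_weight_pos: "1 \<le> q \<Longrightarrow> 0 < cantor_weight q n x"
  by (rule less_le_trans[OF _ cantor_weight_ge]) auto

lemma cantor_weight_le: "1 \<le> q \<Longrightarrow> cantor_weight q n x \<le> 4 ^ n"
proof (induction n arbitrary: x)
  case (Suc n)
  have "1/q \<le> 1" using Suc(2) by simp
  then have "1/q \<le> 4 ^ Suc n" using one_le_power[of "4::real" "Suc n"] by linarith
  with Suc show ?case
    unfolding cantor_weight.simps by (intro graft_all[where P = "\<lambda>z. z \<le> 4 ^ Suc n"]) auto
qed simp

lemma cantor_weight_off: "1 \<le> q \<Longrightarrow> y \<notin> {1/4..3/4} \<Longrightarrow> cantor_weight q n y \<le> 1"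
  by (cases n) (auto simp: graft_off)

lemma bounded_borel_shear [simp]: "bounded_borel (cantor_shear n)"
  by (induction n) (auto intro!: bounded_borel_graft bounded_borel_intros
      bounded_borel_mult[of _ "\<lambda>_. 1/4", simplified])

lemma bounded_borel_weight [simp]: "bounded_borel (cantor_weight q n)"
  by (induction n) (auto intro!: bounded_borel_graft bounded_borel_intros)

section \<open>The dual weight and the spread of the shear\<close>

text \<open>Chosen so that its product with \<open>cantor_weight\<close> is the constant
  \<open>1 / q\<close>, which becomes the determinant of the matrix weight.\<close>

definition dual_weight :: "real \<Rightarrow> nat \<Rightarrow> real \<Rightarrow> real" where
  "dual_weight q n x = 1 / (q * cantor_weight q n x)"

lemma dual_weight_bounds:
  assumes "1 \<le> q" shows "0 < dual_weight q n x" "dual_weight q n x \<le> 1"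
proof -
  have "1 \<le> q * cantor_weight q n x"
    using cantor_weight_ge[OF assms, of n x] assms by (simp add: divide_le_eq mult.commute)
  then show "0 < dual_weight q n x" "dual_weight q n x \<le> 1"
    by (auto simp: dual_weight_def)
qed

lemma bounded_borel_dual_weight:
  assumes "1 \<le> q" shows "bounded_borel (dual_weight q n)"
proof (rule bounded_borelI)
  show "\<bar>dual_weight q n x\<bar> \<le> 1" for x
    using dual_weight_bounds[OF assms, of n x] by simp
  have [measurable]: "cantor_weight q n \<in> borel_measurable borel"
    using bounded_borel_weight[of q n] by (simp add: bounded_borel_def)
  show "dual_weight q n \<in> borel_measurable borel" 
    unfolding dual_weight_def[abs_def] by measurable
qed

lemma dual_weight_Suc:
  "1 \<le> q \<Longrightarrow> dual_weight q (Suc n) = graft 1 (\<lambda>y. 1/4 * dual_weight q n y) (\<lambda>y. 1/4 * dual_weight q n y)"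
  by (auto simp: dual_weight_def graft_def fun_eq_iff)

text \<open>The variance density of the shear about a trial mean \<open>\<gamma>\<close>. Leaving
  \<open>\<gamma>\<close> free makes this family closed under rescaling to a child.\<close>

definition spread :: "real \<Rightarrow> nat \<Rightarrow> real \<Rightarrow> real \<Rightarrow> real" where
  "spread q n \<gamma> x = cantor_weight q n x * (cantor_shear n x - \<gamma>)\<^sup>2"

lemma bounded_borel_spread: "bounded_borel (spread q n \<gamma>)"
  unfolding spread_def[abs_def] by (intro bounded_borel_intros) auto

text \<open>On the left child \<open>g / 4 - 1/2 - \<gamma>\<close> is a quarter of
  \<open>g - (4 * \<gamma> + 2)\<close>; squaring gives 1/16, against the factor 4 of the weight.
  The right child is symmetric.\<close>

lemma spread_Suc:
  "spread q (Suc n) \<gamma> = graft (\<gamma>\<^sup>2 / q) (\<lambda>y. 1/4 * spread q n (4 * \<gamma> + 2) y) (\<lambda>y. 1/4 * spread q n (4 * \<gamma> - 2) y)"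
  by (auto simp: spread_def graft_def fun_eq_iff power2_eq_square algebra_simps)

lemma spread_nonneg: "1 \<le> q \<Longrightarrow> 0 \<le> spread q n \<gamma> x"
  using cantor_weight_pos[of q n x] by (simp add: spread_def)

text \<open>The range up to 5 is needed because a trial mean of size at most 3/4 becomes
  \<open>4 * \<gamma> + 2\<close> or \<open>4 * \<gamma> - 2\<close> in the coordinates of a
  child.\<close>

lemma spread_le:
  assumes "1 \<le> q" "\<bar>\<gamma>\<bar> \<le> 5"
  shows "spread q n \<gamma> x \<le> 36 * cantor_weight q n x"
proof -
  have "\<bar>cantor_shear n x - \<gamma>\<bar> \<le> 6" using abs_cantor_shear_le[of n x] assms by linarith
  then have "(cantor_shear n x - \<gamma>)\<^sup>2 \<le> 6\<^sup>2" using abs_le_square_iff[of "cantor_shear n x - \<gamma>" 6] by simp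
  then show ?thesis
    using cantor_weight_pos[OF assms(1), of n x] mult_left_mono[of _ "36" "cantor_weight q n x"]
    by (simp add: spread_def mult.commute)
qed

text \<open>The factor 4 on two children of length 1/8 preserves the mass, so each stage adds only
  the discarded mass \<open>3 / (4 * q)\<close>. This is what limits the number of stages to about
  \<open>q\<close>.\<close>

lemma unit_integral_cantor_weight:
  assumes "1 \<le> q" shows "unit_integral (cantor_weight q n) \<le> 1 + n / q"
proof (induction n)
  case (Suc n)
  have "unit_integral (cantor_weight q (Suc n)) = unit_integral (cantor_weight q n) + 3/4 * (1/q)"
    by (simp add: unit_integral_graft unit_integral_cmult bounded_borel_intros)
  also have "\<dots> \<le> 1 + n / q + 1/q"
    using Suc assms mult_right_mono[of "3/4" 1 "1/q"] by (intro add_mono) auto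
  finally show ?case using assms by (simp add: add_divide_distrib)
qed (simp add: unit_integral_const)

lemma unit_integral_cantor_weight_le_2:
  assumes "1 \<le> q" "real n \<le> q" shows "unit_integral (cantor_weight q n) \<le> 2"
proof -
  have "n / q \<le> 1" using assms by simp
  then show ?thesis using unit_integral_cantor_weight[OF assms(1), of n] by linarith
qed

lemma unit_integral_dual_weight: "1 \<le> q \<Longrightarrow> unit_integral (dual_weight q n) \<le> 1"
  using unit_integral_mono[of "dual_weight q n" "\<lambda>_. 1"] dual_weight_bounds
  by (simp add: unit_integral_const bounded_borel_dual_weight)

lemma unit_integral_spread:
  assumes "1 \<le> q" "real n \<le> q" "\<bar>\<gamma>\<bar> \<le> 5"
  shows "unit_integral (spread q n \<gamma>) \<le> 72"
proof -
  have "unit_integral (spread q n \<gamma>) \<le> unit_integral (\<lambda>x. 36 * cantor_weight q n x)"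
    by (intro unit_integral_mono bounded_borel_spread bounded_borel_intros bounded_borel_weight
        spread_le assms)
  also have "\<dots> \<le> 72"
    using unit_integral_cantor_weight_le_2[OF assms(1,2)] by (simp add: unit_integral_cmult)
  finally show ?thesis .
qed

lemma cantor_poisson_far:
  assumes q: "1 \<le> q" "real n \<le> q" and t: "0 < t" "x \<notin> {1/8..7/8} \<or> 1 \<le> t"
  shows "poisson_integral (cantor_weight q n) x t \<le> 16"
    and "poisson_integral (dual_weight q n) x t \<le> 8"
    and "\<bar>\<gamma>\<bar> \<le> 5 \<Longrightarrow> poisson_integral (spread q n \<gamma>) x t \<le> 576"
proof -
  have "poisson_integral (cantor_weight q n) x t \<le> 8 * 2"
    by (rule poisson_integral_far[OF bounded_borel_weight _ _ unit_integral_cantor_weight_le_2[OF q] t])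
       (simp_all add: less_imp_le[OF cantor_weight_pos[OF q(1)]] order_trans[OF cantor_weight_off[OF q(1)]])
  then show "poisson_integral (cantor_weight q n) x t \<le> 16" by simp
  have "poisson_integral (dual_weight q n) x t \<le> 8 * 1"
    by (rule poisson_integral_far[OF bounded_borel_dual_weight[OF q(1)] _ _ unit_integral_dual_weight[OF q(1)] t])
       (simp_all add: less_imp_le[OF dual_weight_bounds(1)[OF q(1)]] dual_weight_bounds(2)[OF q(1)])
  then show "poisson_integral (dual_weight q n) x t \<le> 8" by simp
  assume g: "\<bar>\<gamma>\<bar> \<le> 5"
  have off: "spread q n \<gamma> y \<le> 72" if "y \<notin> {1/4..3/4}" for y
    using spread_le[OF q(1) g, of n y] cantor_weight_off[OF q(1) that, of n] by simp
  have "poisson_integral (spread q n \<gamma>) x t \<le> 8 * 72"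
    by (rule poisson_integral_far[OF bounded_borel_spread spread_nonneg[OF q(1)] off unit_integral_spread[OF q g] t])
  then show "poisson_integral (spread q n \<gamma>) x t \<le> 576" by simp
qed

text \<open>The slack \<open>K t\<close> grows by the factor 8 when a child is rescaled to the unit interval, and the part
  of \<open>m\<close> it uses up changes by a factor 4 at most.  What remains pays for the density outside the
  child, so that the constant 8000 does not deteriorate from one stage to the next.\<close>

definition poisson_controlled :: "real \<Rightarrow> nat \<Rightarrow> real \<Rightarrow> real \<Rightarrow> real \<Rightarrow> real \<Rightarrow> real \<Rightarrow> bool" where
  "poisson_controlled q n x t m \<gamma> K \<longleftrightarrow>
     poisson_integral (cantor_weight q n) x t + K * t \<le> 8000 * m \<and>
     poisson_integral (dual_weight q n) x t + K * t \<le> 8000 / m \<and>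
     poisson_integral (spread q n \<gamma>) x t + K * t \<le> 8000 / m"

text \<open>If the point lies low over the middle of a child, the induction hypothesis applies in
  child coordinates, and \<open>4 * m\<close> with a rescaled mean serves for the parent. Otherwise
  \<open>m = 1\<close> and \<open>\<gamma> = 0\<close> do. Thus \<open>m\<close> is a power of 4
  counting the descents.\<close>

lemma poisson_controlled_unit_scale:
  assumes q: "1 \<le> q" "real n \<le> q" and t: "0 < t" "t \<le> 1"
  shows "\<exists>m \<gamma>. 0 < m \<and> \<bar>\<gamma>\<bar> \<le> 1 \<and> poisson_controlled q n x t m \<gamma> 3000"
  using q(2) t
proof (induction n arbitrary: x t)
  case 0
  have "dual_weight q 0 = (\<lambda>_. 1/q)" "spread q 0 0 = (\<lambda>_. 0)"
    by (auto simp: dual_weight_def spread_def)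
  moreover have "pi / q \<le> 4"
    using pi_less_4 q by (simp add: divide_le_eq)
  ultimately have "poisson_controlled q 0 x t 1 0 3000"
    using 0 q pi_less_4 by (simp add: poisson_controlled_def poisson_integral_const)
  then show ?case by (intro exI[of _ 1] exI[of _ 0]) simp
next
  case (Suc n)
  have n: "real n \<le> q" using Suc.prems by simp
  have w0: "0 \<le> cantor_weight q n y" and d0: "0 \<le> dual_weight q n y" for y
    using cantor_weight_pos[OF q(1), of n y] dual_weight_bounds[OF q(1), of n y] by auto
  have s0: "0 \<le> spread q n \<gamma> y" for \<gamma> y by (rule spread_nonneg[OF q(1)])
  note iw = unit_integral_cantor_weight_le_2[OF q(1) n]
  note id = unit_integral_dual_weight[OF q(1), of n]
  have iq: "0 \<le> 1/q" "1/q \<le> 1" using q(1) by auto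
  note bb = bounded_borel_dual_weight[OF q(1)] bounded_borel_spread bounded_borel_intros bounded_borel_weight
  note pc = poisson_integral_cmult unit_integral_cmult
  let ?t = "8 * t"
  \<comment> \<open>The coefficients of \<open>t\<close> are at most \<open>2 * 4 * 2 + 512\<close>
    for the weight, \<open>2 / 4 + 512\<close> for the dual weight and, further down,
    \<open>2 * 72 / 4 + 512\<close> for the spread, all below 600.\<close>
  have w_near: "poisson_integral (cantor_weight q (Suc n)) x t \<le>
      4 * poisson_integral (cantor_weight q n) (8 * x - c) ?t + 600 * t"
    and d_near: "poisson_integral (dual_weight q (Suc n)) x t \<le>
      1/4 * poisson_integral (dual_weight q n) (8 * x - c) ?t + 600 * t"
    if c: "c = 2 \<or> c = 5" "8 * x - c \<in> {1/8..7/8}" for c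
  proof -
    have "poisson_integral (cantor_weight q (Suc n)) x t \<le>
      4 * poisson_integral (cantor_weight q n) (8 * x - c) ?t + t * (2 * (4 * unit_integral (cantor_weight q n)) + 512 * (1/q))"
      using c poisson_integral_graft_near[of "\<lambda>y. 4 * cantor_weight q n y" "\<lambda>y. 4 * cantor_weight q n y" t "1/q" x]
        w0 iq(1) Suc.prems(2) by (auto simp: pc bb)
    also have "\<dots> \<le> 4 * poisson_integral (cantor_weight q n) (8 * x - c) ?t + t * 600"
      using iw iq(2) Suc.prems(2) by (intro add_left_mono mult_left_mono) auto
    finally show "poisson_integral (cantor_weight q (Suc n)) x t \<le>
      4 * poisson_integral (cantor_weight q n) (8 * x - c) ?t + 600 * t" by (simp add: mult.commute)
    have "poisson_integral (dual_weight q (Suc n)) x t \<le>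
      1/4 * poisson_integral (dual_weight q n) (8 * x - c) ?t + t * (2 * (1/4 * unit_integral (dual_weight q n)) + 512 * 1)"
      unfolding dual_weight_Suc[OF q(1)] using c
        poisson_integral_graft_near[of "\<lambda>y. 1/4 * dual_weight q n y" "\<lambda>y. 1/4 * dual_weight q n y" t 1 x]
        d0 Suc.prems(2) by (auto simp: pc bb simp del: times_divide_eq_left)
    also have "\<dots> \<le> 1/4 * poisson_integral (dual_weight q n) (8 * x - c) ?t + t * 600"
      using id Suc.prems(2) by (intro add_left_mono mult_left_mono) auto
    finally show "poisson_integral (dual_weight q (Suc n)) x t \<le>
      1/4 * poisson_integral (dual_weight q n) (8 * x - c) ?t + 600 * t" by (simp add: mult.commute)
  qed
  have s_near2: "poisson_integral (spread q (Suc n) \<gamma>) x t \<le>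
      1/4 * poisson_integral (spread q n (4 * \<gamma> + 2)) (8 * x - 2) ?t + 600 * t"
    if "8 * x - 2 \<in> {1/8..7/8}" and g: "\<bar>\<gamma>\<bar> \<le> 3/4" for \<gamma>
  proof -
    have "\<gamma>\<^sup>2 \<le> 1" using g by (simp add: abs_square_le_1)
    then have g2: "\<gamma>\<^sup>2 / q \<le> 1" "0 \<le> \<gamma>\<^sup>2 / q" using q(1) by (auto simp: divide_le_eq)
    have "poisson_integral (spread q (Suc n) \<gamma>) x t \<le>
      1/4 * poisson_integral (spread q n (4 * \<gamma> + 2)) (8 * x - 2) ?t
        + t * (2 * (1/4 * unit_integral (spread q n (4 * \<gamma> - 2))) + 512 * (\<gamma>\<^sup>2 / q))"
      unfolding spread_Suc using that(1)
        poisson_integral_graft_near(1)[of "\<lambda>y. 1/4 * spread q n (4 * \<gamma> + 2) y" "\<lambda>y. 1/4 * spread q n (4 * \<gamma> - 2) y" t "\<gamma>\<^sup>2/q" x]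
        s0 Suc.prems(2) g2(2) by (auto simp: pc bb simp del: times_divide_eq_left)
    also have "\<dots> \<le> 1/4 * poisson_integral (spread q n (4 * \<gamma> + 2)) (8 * x - 2) ?t + t * 600"
    proof (intro add_left_mono mult_left_mono)
      have "\<bar>4 * \<gamma> - 2\<bar> \<le> 5" using g by linarith
      then show "2 * (1/4 * unit_integral (spread q n (4 * \<gamma> - 2))) + 512 * (\<gamma>\<^sup>2 / q) \<le> 600"
        using unit_integral_spread[OF q(1) n, of "4 * \<gamma> - 2"] g2(1) by linarith
    qed (use Suc.prems(2) in simp)
    finally show ?thesis by (simp add: mult.commute)
  qed
  have s_near5: "poisson_integral (spread q (Suc n) \<gamma>) x t \<le>
      1/4 * poisson_integral (spread q n (4 * \<gamma> - 2)) (8 * x - 5) ?t + 600 * t"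
    if "8 * x - 5 \<in> {1/8..7/8}" and g: "\<bar>\<gamma>\<bar> \<le> 3/4" for \<gamma>
  proof -
    have "\<gamma>\<^sup>2 \<le> 1" using g by (simp add: abs_square_le_1)
    then have g2: "\<gamma>\<^sup>2 / q \<le> 1" "0 \<le> \<gamma>\<^sup>2 / q" using q(1) by (auto simp: divide_le_eq)
    have "poisson_integral (spread q (Suc n) \<gamma>) x t \<le>
      1/4 * poisson_integral (spread q n (4 * \<gamma> - 2)) (8 * x - 5) ?t
        + t * (2 * (1/4 * unit_integral (spread q n (4 * \<gamma> + 2))) + 512 * (\<gamma>\<^sup>2 / q))"
      unfolding spread_Suc using that(1)
        poisson_integral_graft_near(2)[of "\<lambda>y. 1/4 * spread q n (4 * \<gamma> + 2) y" "\<lambda>y. 1/4 * spread q n (4 * \<gamma> - 2) y" t "\<gamma>\<^sup>2/q" x]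
        s0 Suc.prems(2) g2(2) by (auto simp: pc bb simp del: times_divide_eq_left)
    also have "\<dots> \<le> 1/4 * poisson_integral (spread q n (4 * \<gamma> - 2)) (8 * x - 5) ?t + t * 600"
    proof (intro add_left_mono mult_left_mono)
      have "\<bar>4 * \<gamma> + 2\<bar> \<le> 5" using g by linarith
      then show "2 * (1/4 * unit_integral (spread q n (4 * \<gamma> + 2))) + 512 * (\<gamma>\<^sup>2 / q) \<le> 600"
        using unit_integral_spread[OF q(1) n, of "4 * \<gamma> + 2"] g2(1) by linarith
    qed (use Suc.prems(2) in simp)
    finally show ?thesis by (simp add: mult.commute)
  qed
  have near: ?case
    if c: "c = 2 \<and> s = -2 \<or> c = 5 \<and> s = (2::real)" "8 * x - c \<in> {1/8..7/8}" "?t \<le> 1" for c s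
  proof -
    obtain m \<gamma> where m: "0 < m" "\<bar>\<gamma>\<bar> \<le> 1" "poisson_controlled q n (8 * x - c) ?t m \<gamma> 3000"
      using Suc.IH[of ?t "8 * x - c"] n Suc.prems(2) c(3) by auto
    \<comment> \<open>The trial mean on the parent that the child sees as
      \<open>\<gamma>\<close>.\<close>
    define \<gamma>' where "\<gamma>' = (\<gamma> + s) / 4"
    have g: "\<bar>\<gamma>'\<bar> \<le> 3/4" "4 * \<gamma>' - s = \<gamma>" using m c(1) by (auto simp: \<gamma>'_def field_simps)
    have "poisson_integral (spread q (Suc n) \<gamma>') x t \<le>
      1/4 * poisson_integral (spread q n \<gamma>) (8 * x - c) ?t + 600 * t"
      using s_near2[of \<gamma>'] s_near5[of \<gamma>'] g c by auto
    moreover have "8000 / (4 * m) = 1/4 * (8000 / m)" by simp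
    \<comment> \<open>The hypothesis has slack \<open>3000 * (8 * t)\<close>. Even a quarter of it,
      \<open>6000 * t\<close>, pays for the error \<open>600 * t\<close> and the new slack
      \<open>3000 * t\<close>.\<close>
    ultimately have "poisson_controlled q (Suc n) x t (4 * m) \<gamma>' 3000"
      using w_near[of c] d_near[of c] c m(3) Suc.prems(2) unfolding poisson_controlled_def by auto
    then show ?thesis using m(1) g(1) by (intro exI[of _ "4 * m"] exI[of _ \<gamma>']) auto
  qed
  \<comment> \<open>With no child nearby the three Poisson integrals are at most 132, 20 and 288,
    which leaves room for the slack 3000 below 8000.\<close>
  have far: ?case
    if c: "8 * x - 2 \<notin> {1/8..7/8} \<or> 1 \<le> ?t" "8 * x - 5 \<notin> {1/8..7/8} \<or> 1 \<le> ?t"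
  proof -
    have w: "poisson_integral (cantor_weight q (Suc n)) x t \<le> 16 * 8 + 4 * (1/q)"
      unfolding cantor_weight.simps using iw w0 cantor_weight_off[OF q(1), of _ n] c iq(1)
      by (intro poisson_integral_graft_far Suc.prems(2))
        (force simp: pc intro!: bounded_borel_intros bounded_borel_weight)+
    have dq: "bounded_borel (\<lambda>y. 1/4 * dual_weight q n y)" by (intro bb)
    have dn: "0 \<le> 1/4 * dual_weight q n y" "1/4 * dual_weight q n y \<le> 1" for y
      using dual_weight_bounds[OF q(1), of n y] by auto
    have di: "unit_integral (\<lambda>y. 1/4 * dual_weight q n y) \<le> 1"
      using id unfolding unit_integral_cmult by linarith
    have d: "poisson_integral (dual_weight q (Suc n)) x t \<le> 16 * 1 + 4 * 1"
      unfolding dual_weight_Suc[OF q(1)]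
      by (rule poisson_integral_graft_far[OF dq dn di dq dn di Suc.prems(2) c]) simp
    have off: "1/4 * spread q n g y \<le> 18" if "\<bar>g\<bar> \<le> 5" "y \<notin> {1/4..3/4}" for g y
      using spread_le[OF q(1) that(1), of n y] cantor_weight_off[OF q(1) that(2), of n] by simp
    have sq: "bounded_borel (\<lambda>y. 1/4 * spread q n g y)" for g by (intro bb)
    have sn: "0 \<le> 1/4 * spread q n g y" for g y using s0[of g y] by simp
    have si: "unit_integral (\<lambda>y. 1/4 * spread q n g y) \<le> 18" if "\<bar>g\<bar> \<le> 5" for g
      using unit_integral_spread[OF q(1) n that] unfolding unit_integral_cmult by linarith
    have s: "poisson_integral (spread q (Suc n) 0) x t \<le> 16 * 18 + 4 * (0\<^sup>2 / q)"
      unfolding spread_Suc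
      by (rule poisson_integral_graft_far[OF sq sn off si sq sn off si Suc.prems(2) c]) auto
    have "poisson_controlled q (Suc n) x t 1 0 3000"
      using w d s iq Suc.prems(3) unfolding poisson_controlled_def by auto
    then show ?thesis by (intro exI[of _ 1] exI[of _ 0]) auto
  qed
  show ?case
    using near[of 2 "-2"] near[of 5 2] far by fastforce
qed

text \<open>Up to height 1 the slack is dropped; above it the far bounds give the claim with
  \<open>m = 1\<close> and \<open>\<gamma> = 0\<close>.\<close>

lemma poisson_controlled_all_scales:
  assumes q: "1 \<le> q" "real n \<le> q" and t: "0 < t"
  shows "\<exists>m \<gamma>. 0 < m \<and> poisson_controlled q n x t m \<gamma> 0"
proof (cases "t \<le> 1")
  case True
  obtain m \<gamma> where m: "0 < m" "poisson_controlled q n x t m \<gamma> 3000"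
    using poisson_controlled_unit_scale[OF q t True] by blast
  have "poisson_controlled q n x t m \<gamma> 0"
    using m(2) t unfolding poisson_controlled_def by auto
  then show ?thesis using m by blast
next
  case False
  then have far: "x \<notin> {1/8..7/8} \<or> 1 \<le> t" by simp
  have "poisson_controlled q n x t 1 0 0"
    using cantor_poisson_far(1,2)[OF q t far] cantor_poisson_far(3)[OF q t far, of 0]
    by (simp add: poisson_controlled_def)
  then show ?thesis by (intro exI[of _ 1] exI[of _ 0]) auto
qed

section \<open>Symmetric 2 by 2 matrices\<close>

definition sym2 :: "real \<Rightarrow> real \<Rightarrow> real \<Rightarrow> real^2^2" where
  "sym2 a b c = (\<chi> i j. if i = 1 then (if j = 1 then a else b) else (if j = 1 then b else c))"

lemma sym2_nth [simp]:
  "sym2 a b c $ 1 $ 1 = a" "sym2 a b c $ 1 $ 2 = b" "sym2 a b c $ 2 $ 1 = b" "sym2 a b c $ 2 $ 2 = c"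
  by (simp_all add: sym2_def)

lemma sym2_eq_iff: "A = sym2 a b c \<longleftrightarrow> A $ 1 $ 1 = a \<and> A $ 1 $ 2 = b \<and> A $ 2 $ 1 = b \<and> A $ 2 $ 2 = c"
  by (auto simp: vec_eq_iff forall_2)

lemma transpose_eq_iff_sym2: "transpose A = A \<longleftrightarrow> A = sym2 (A $ 1 $ 1) (A $ 1 $ 2) (A $ 2 $ 2)"
  by (auto simp: vec_eq_iff forall_2 transpose_def)

lemma transpose_sym2 [simp]: "transpose (sym2 a b c) = sym2 a b c"
  by (auto simp: vec_eq_iff forall_2 transpose_def)

lemma scaleR_sym2: "r *\<^sub>R sym2 a b c = sym2 (r * a) (r * b) (r * c)"
  by (auto simp: vec_eq_iff forall_2)

lemma sym2_quadratic_form: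
  "(sym2 a b c *v v) \<bullet> v = a * (v$1)\<^sup>2 + 2 * b * (v$1) * (v$2) + c * (v$2)\<^sup>2"
  by (simp add: matrix_vector_mult_def inner_vec_def sum_2 power2_eq_square algebra_simps)

text \<open>Completing the square; both definiteness criteria rest on it.\<close>

lemma sym2_form_eq:
  "a * (a * x\<^sup>2 + 2 * b * x * y + c * y\<^sup>2) = (a * x + b * y)\<^sup>2 + (a * c - b\<^sup>2) * (y::real)\<^sup>2"
  by (simp add: power2_eq_square algebra_simps)

lemma pos_def_sym2:
  assumes "0 < a" "b\<^sup>2 < a * c" shows "pos_def_matrix (sym2 a b c)"
  unfolding pos_def_matrix_def sym2_quadratic_form
proof (intro conjI allI impI transpose_sym2)
  fix v :: "real^2" assume v: "v \<noteq> 0"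
  have "0 < (a * v$1 + b * v$2)\<^sup>2 + (a * c - b\<^sup>2) * (v$2)\<^sup>2"
  proof (cases "v$2 = 0")
    case True
    then show ?thesis using v assms by (auto simp: vec_eq_iff forall_2)
  next
    case False
    then show ?thesis using assms by (intro add_nonneg_pos mult_pos_pos) auto
  qed
  then show "0 < a * (v$1)\<^sup>2 + 2 * b * (v$1) * (v$2) + c * (v$2)\<^sup>2"
    using assms(1) unfolding sym2_form_eq[symmetric] by (simp add: zero_less_mult_iff)
qed

text \<open>All principal minors occur, since \<open>a\<close> may be 0. The forward direction tests
  the form on \<open>(- (c + 1), b)\<close> if \<open>a = 0\<close> and on \<open>(- b, a)\<close>
  otherwise.\<close>

lemma pos_semidef_sym2_iff:
  "pos_semidef_matrix (sym2 a b c) \<longleftrightarrow> 0 \<le> a \<and> 0 \<le> c \<and> b\<^sup>2 \<le> a * c"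
proof
  assume "pos_semidef_matrix (sym2 a b c)"
  then have nonneg: "0 \<le> a * x\<^sup>2 + 2 * b * x * y + c * y\<^sup>2" for x y
    unfolding pos_semidef_matrix_def sym2_quadratic_form
    by (auto dest!: spec[of _ "\<chi> i. if i = 1 then x else y"])
  have ac: "0 \<le> a" "0 \<le> c" using nonneg[of 1 0] nonneg[of 0 1] by simp_all
  have "b\<^sup>2 \<le> a * c"
  proof (cases "a = 0")
    case True
    have "0 \<le> 2 * b * (- (c + 1) * b) + c * b\<^sup>2" using nonneg[of "- (c + 1)" b] True
      by (simp add: algebra_simps power2_eq_square)
    then have "0 \<le> - (c + 2) * b\<^sup>2" by (simp add: power2_eq_square algebra_simps)
    then show ?thesis using True ac by (simp add: zero_le_mult_iff)
  next
    case False
    have "0 \<le> a * (a * c - b\<^sup>2)" using nonneg[of "- b" a] by (simp add: power2_eq_square algebra_simps)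
    then show ?thesis using False ac by (simp add: zero_le_mult_iff)
  qed
  then show "0 \<le> a \<and> 0 \<le> c \<and> b\<^sup>2 \<le> a * c" using ac by simp
next
  assume *: "0 \<le> a \<and> 0 \<le> c \<and> b\<^sup>2 \<le> a * c"
  have "0 \<le> a * x\<^sup>2 + 2 * b * x * y + c * y\<^sup>2" for x y
  proof (cases "a = 0")
    case True
    then show ?thesis using * by simp
  next
    case False
    have "0 \<le> (a * x + b * y)\<^sup>2 + (a * c - b\<^sup>2) * y\<^sup>2" using * by simp
    then show ?thesis using False * unfolding sym2_form_eq[symmetric] by (simp add: zero_le_mult_iff)
  qed
  then show "pos_semidef_matrix (sym2 a b c)"
    unfolding pos_semidef_matrix_def sym2_quadratic_form by simp
qed

lemma sym2_square: "sym2 p r u ** sym2 p r u = sym2 (p\<^sup>2 + r\<^sup>2) (r * (p + u)) (r\<^sup>2 + u\<^sup>2)"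
  by (simp add: vec_eq_iff forall_2 matrix_matrix_mult_def sum_2 power2_eq_square algebra_simps)

text \<open>By Cayley--Hamilton a root \<open>B\<close> satisfies \<open>B\<^sup>2 - (tr B) B + det B = 0\<close>, and the trace and
  the determinant of \<open>B\<close> are determined by those of \<open>A\<close>.\<close>

lemma matrix_sqrt_sym2:
  assumes "0 < a" "b\<^sup>2 < a * c"
  shows "\<exists>p r u. matrix_sqrt (sym2 a b c) = sym2 p r u \<and> sym2 p r u ** sym2 p r u = sym2 a b c"
proof -
  \<comment> \<open>For \<open>A = sym2 a b c\<close>, \<open>s\<close> is the determinant and
    \<open>\<tau>\<close> the trace of the root, which is therefore
    \<open>(A + s I) / \<tau>\<close>.\<close>
  define s where "s = sqrt (a * c - b\<^sup>2)"
  define \<tau> where "\<tau> = sqrt (a + c + 2 * s)"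
  have "0 < a * c" using assms(2) zero_le_power2[of b] by linarith
  then have c: "0 < c" using assms(1) by (simp add: zero_less_mult_iff)
  have s: "0 < s" "s\<^sup>2 = a * c - b\<^sup>2" using assms(2) by (auto simp: s_def)
  have \<tau>: "0 < \<tau>" "\<tau>\<^sup>2 = a + c + 2 * s" using assms(1) c s by (auto simp: \<tau>_def)
  let ?P = "\<lambda>B. pos_semidef_matrix B \<and> B ** B = sym2 a b c"
  have "?P (sym2 ((a + s) / \<tau>) (b / \<tau>) ((c + s) / \<tau>))"
  proof
    have "(a + s) * (c + s) - b\<^sup>2 = s * \<tau>\<^sup>2" using s \<tau> by (simp add: power2_eq_square algebra_simps)
    then have "b\<^sup>2 \<le> (a + s) * (c + s)" using s(1) zero_le_power2[of \<tau>] by (smt (verit) mult_nonneg_nonneg)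
    then show "pos_semidef_matrix (sym2 ((a + s) / \<tau>) (b / \<tau>) ((c + s) / \<tau>))"
      unfolding pos_semidef_sym2_iff using assms c s \<tau>
      by (simp add: power_divide power2_eq_square divide_right_mono)
    have "(a + s)\<^sup>2 + b\<^sup>2 = a * \<tau>\<^sup>2" "b\<^sup>2 + (c + s)\<^sup>2 = c * \<tau>\<^sup>2"
      using s \<tau> by (simp_all add: power2_eq_square algebra_simps)
    then have diag: "((a + s) / \<tau>)\<^sup>2 + (b / \<tau>)\<^sup>2 = a" "(b / \<tau>)\<^sup>2 + ((c + s) / \<tau>)\<^sup>2 = c"
      using \<tau>(1) by (simp_all add: power_divide add_divide_distrib[symmetric])
    have "a + s + (c + s) = \<tau> * \<tau>" using \<tau>(2) by (simp add: power2_eq_square)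
    then have tr: "(a + s) / \<tau> + (c + s) / \<tau> = \<tau>"
      using \<tau>(1) by (simp only: add_divide_distrib[symmetric]) simp
    show "sym2 ((a + s) / \<tau>) (b / \<tau>) ((c + s) / \<tau>) ** sym2 ((a + s) / \<tau>) (b / \<tau>) ((c + s) / \<tau>) = sym2 a b c"
      unfolding sym2_square diag tr using \<tau>(1) by simp
  qed
  moreover have "B = sym2 ((a + s) / \<tau>) (b / \<tau>) ((c + s) / \<tau>)" if B: "?P B" for B
  proof -
    obtain p r u where Beq: "B = sym2 p r u"
      using B by (auto simp: pos_semidef_matrix_def transpose_eq_iff_sym2)
    have psd: "0 \<le> p" "0 \<le> u" "r\<^sup>2 \<le> p * u" using B by (auto simp: Beq pos_semidef_sym2_iff)
    have sq: "p\<^sup>2 + r\<^sup>2 = a" "r * (p + u) = b" "r\<^sup>2 + u\<^sup>2 = c"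
      using B unfolding Beq sym2_square by (auto simp: sym2_eq_iff)
    have "(p * u - r\<^sup>2)\<^sup>2 = s\<^sup>2" unfolding s(2) sq[symmetric] by (simp add: power2_eq_square algebra_simps)
    then have d: "p * u - r\<^sup>2 = s" using psd s(1) by (simp add: power2_eq_iff_nonneg)
    have "(p + u)\<^sup>2 = \<tau>\<^sup>2" unfolding \<tau>(2) sq(1,3)[symmetric] d[symmetric]
      by (simp add: power2_eq_square algebra_simps)
    then have t: "p + u = \<tau>" using psd \<tau>(1) by (simp add: power2_eq_iff_nonneg)
    have "p * \<tau> = a + s" "u * \<tau> = c + s" "r * \<tau> = b"
      unfolding t[symmetric] sq[symmetric] d[symmetric] by (simp_all add: power2_eq_square algebra_simps)
    then show ?thesis unfolding Beq using \<tau>(1) by (metis nonzero_mult_div_cancel_right less_irrefl)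
  qed
  ultimately have "?P (matrix_sqrt (sym2 a b c))"
    and "matrix_sqrt (sym2 a b c) = sym2 ((a + s) / \<tau>) (b / \<tau>) ((c + s) / \<tau>)"
    unfolding matrix_sqrt_def using theI[of ?P] the_equality[of ?P] by blast+
  then show ?thesis by auto
qed

text \<open>The operator norm is at most the Hilbert-Schmidt norm, and the squared Hilbert-Schmidt
  norm of the product of the roots of \<open>A\<close> and \<open>B\<close> is the trace of
  \<open>A B\<close>.\<close>

lemma onorm_matrix_sqrt_mult_le:
  assumes A: "0 < a" "b\<^sup>2 < a * c" and B: "0 < a'" "b'\<^sup>2 < a' * c'"
  shows "(onorm (\<lambda>v. (matrix_sqrt (sym2 a b c) ** matrix_sqrt (sym2 a' b' c')) *v v))\<^sup>2
    \<le> a * a' + 2 * b * b' + c * c'"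
proof -
  obtain p r u where S: "matrix_sqrt (sym2 a b c) = sym2 p r u" "sym2 p r u ** sym2 p r u = sym2 a b c"
    using matrix_sqrt_sym2[OF A] by blast
  obtain p' r' u' where T: "matrix_sqrt (sym2 a' b' c') = sym2 p' r' u'" "sym2 p' r' u' ** sym2 p' r' u' = sym2 a' b' c'"
    using matrix_sqrt_sym2[OF B] by blast
  define M where "M = sym2 p r u ** sym2 p' r' u'"
  let ?F = "(M$1$1)\<^sup>2 + (M$1$2)\<^sup>2 + (M$2$1)\<^sup>2 + (M$2$2)\<^sup>2"
  have trace: "?F = a * a' + 2 * b * b' + c * c'"
  proof -
    have "p\<^sup>2 + r\<^sup>2 = a" "r * (p + u) = b" "r\<^sup>2 + u\<^sup>2 = c"
      "p'\<^sup>2 + r'\<^sup>2 = a'" "r' * (p' + u') = b'" "r'\<^sup>2 + u'\<^sup>2 = c'"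
      using S(2) T(2) unfolding sym2_square by (auto simp: sym2_eq_iff)
    then show ?thesis
      by (auto simp: M_def matrix_matrix_mult_def sum_2 power2_eq_square algebra_simps)
  qed
  have "norm (M *v v) \<le> sqrt ?F * norm v" for v
  proof -
    have CS: "(x * y + z * w)\<^sup>2 \<le> (x\<^sup>2 + z\<^sup>2) * (y\<^sup>2 + w\<^sup>2)" for x y z w :: real
      using zero_le_power2[of "x * w - z * y"] by (simp add: power2_eq_square algebra_simps)
    have nv: "(norm (w::real^2))\<^sup>2 = (w$1)\<^sup>2 + (w$2)\<^sup>2" for w
      by (simp add: norm_vec_def L2_set_def sum_2)
    have "(norm (M *v v))\<^sup>2 \<le> ?F * (norm v)\<^sup>2"
      using CS[of "M$1$1" "v$1" "M$1$2" "v$2"] CS[of "M$2$1" "v$1" "M$2$2" "v$2"]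
      by (simp add: nv matrix_vector_mult_def sum_2 algebra_simps)
    then have "sqrt ((norm (M *v v))\<^sup>2) \<le> sqrt (?F * (norm v)\<^sup>2)" by (rule real_sqrt_le_mono)
    then show ?thesis by (simp add: real_sqrt_mult)
  qed
  then have "onorm ((*v) M) \<le> sqrt ?F" by (rule onorm_le)
  moreover have "0 \<le> onorm ((*v) M)" by (rule onorm_pos_le) (simp add: matrix_vector_mul_bounded_linear)
  ultimately have "(onorm ((*v) M))\<^sup>2 \<le> (sqrt ?F)\<^sup>2" by (rule power_mono)
  also have "\<dots> = ?F" by simp
  finally show ?thesis unfolding S(1) T(1) M_def[symmetric] trace .
qed

text \<open>\<open>matrix_inv\<close> is defined by choice, so the explicit inverse is identified
  through uniqueness of inverses.\<close>

lemma matrix_inv_sym2: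
  assumes "a * c - b\<^sup>2 = D" "D \<noteq> 0"
  shows "matrix_inv (sym2 a b c) = sym2 (c / D) (- b / D) (a / D)"
proof -
  have inv: "sym2 a b c ** sym2 (c / D) (- b / D) (a / D) = mat 1"
    "sym2 (c / D) (- b / D) (a / D) ** sym2 a b c = mat 1"
    using assms by (auto simp: vec_eq_iff forall_2 matrix_matrix_mult_def sum_2 mat_def field_simps power2_eq_square)
  let ?A = "sym2 a b c" and ?B = "sym2 (c / D) (- b / D) (a / D)"
  have left: "matrix_inv ?A ** ?A = mat 1"
    using someI[where P = "\<lambda>B. ?A ** B = mat 1 \<and> B ** ?A = mat 1", OF conjI[OF inv]]
    unfolding matrix_inv_def by blast
  have "matrix_inv ?A = matrix_inv ?A ** (?A ** ?B)" by (simp only: inv(1) matrix_mul_rid)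
  also have "\<dots> = ?B" by (simp add: matrix_mul_assoc left)
  finally show ?thesis .
qed

section \<open>Integration of symmetric matrix functions\<close>

lemma has_bochner_integral_sym2:
  assumes "has_bochner_integral M a A" "has_bochner_integral M b B" "has_bochner_integral M c C"
  shows "has_bochner_integral M (\<lambda>x. sym2 (a x) (b x) (c x)) (sym2 A B C)"
proof -
  have eq: "sym2 a b c = a *\<^sub>R sym2 1 0 0 + b *\<^sub>R sym2 0 1 0 + c *\<^sub>R sym2 0 0 1" for a b c
    by (simp add: vec_eq_iff forall_2)
  show ?thesis
    unfolding eq[of "a _"] eq[of A]
    by (intro has_bochner_integral_add has_bochner_integral_scaleR_left assms)
qed

text \<open>Transfers the estimates, made over \<open>lborel\<close>, to the completed measure of
  the definitions.\<close>

lemma has_bochner_integral_lebesgue: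
  fixes f :: "real \<Rightarrow> 'a :: {banach, second_countable_topology}"
  assumes "has_bochner_integral lborel f I"
  shows "has_bochner_integral lebesgue f I"
  using assms borel_measurable_has_bochner_integral[OF assms]
  by (simp add: has_bochner_integral_iff integrable_completion integral_completion)

lemma poisson_sym2:
  assumes "bounded_borel a" "bounded_borel b" "bounded_borel c" "0 < t"
  shows "poisson_integrable (\<lambda>y. sym2 (a y) (b y) (c y)) x t"
    and "poisson_ext (\<lambda>y. sym2 (a y) (b y) (c y)) x t =
      sym2 (poisson_integral a x t / pi) (poisson_integral b x t / pi) (poisson_integral c x t / pi)"
proof -
  have "has_bochner_integral lebesgue (\<lambda>y. poisson_kernel x t y *\<^sub>R sym2 (a y) (b y) (c y))
    (sym2 (poisson_integral a x t) (poisson_integral b x t) (poisson_integral c x t))"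
    unfolding scaleR_sym2 poisson_integral_def
    by (intro has_bochner_integral_lebesgue has_bochner_integral_sym2 has_bochner_integral_integrable
        integrable_poisson assms)
  then show "poisson_integrable (\<lambda>y. sym2 (a y) (b y) (c y)) x t"
    and "poisson_ext (\<lambda>y. sym2 (a y) (b y) (c y)) x t =
      sym2 (poisson_integral a x t / pi) (poisson_integral b x t / pi) (poisson_integral c x t / pi)"
    by (simp_all add: poisson_integrable_def poisson_ext_def has_bochner_integral_iff scaleR_sym2)
qed

lemma absolutely_integrable_sym2:
  assumes "bounded_borel a" "bounded_borel b" "bounded_borel c" "compact K"
  shows "(\<lambda>y. sym2 (a y) (b y) (c y)) absolutely_integrable_on K"
proof -
  have "integrable lborel (indicator K :: real \<Rightarrow> real)"
    using assms(4) emeasure_compact_finite[OF assms(4)]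
    by (intro integrable_real_indicator) (auto simp: borel_compact)
  note i = integrable_mult_bounded_borel[OF this]
  have "has_bochner_integral lebesgue (\<lambda>y. indicator K y *\<^sub>R sym2 (a y) (b y) (c y))
      (sym2 (\<integral>y. indicator K y * a y \<partial>lborel) (\<integral>y. indicator K y * b y \<partial>lborel)
        (\<integral>y. indicator K y * c y \<partial>lborel))"
    unfolding scaleR_sym2
    by (intro has_bochner_integral_lebesgue has_bochner_integral_sym2 has_bochner_integral_integrable i assms)
  then show ?thesis by (auto simp: set_integrable_def has_bochner_integral_iff)
qed

section \<open>The matrix weight and its characteristic\<close>

definition cantor_matrix :: "real \<Rightarrow> nat \<Rightarrow> real \<Rightarrow> real^2^2" where
  "cantor_matrix q n x = sym2 (cantor_weight q n x) (cantor_weight q n x * cantor_shear n x)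
     (cantor_weight q n x * (cantor_shear n x)\<^sup>2 + dual_weight q n x)"

lemma cantor_matrix_form:
  "(cantor_matrix q n x *v v) \<bullet> v
    = cantor_weight q n x * (v$1 + cantor_shear n x * v$2)\<^sup>2 + dual_weight q n x * (v$2)\<^sup>2"
  by (simp add: cantor_matrix_def sym2_quadratic_form power2_eq_square algebra_simps)

lemma weight_mult_dual: "1 \<le> q \<Longrightarrow> cantor_weight q n x * dual_weight q n x = 1 / q"
  using cantor_weight_pos[of q n x] by (simp add: dual_weight_def)

text \<open>The determinant is the constant \<open>1 / q\<close>, so the inverse is \<open>q\<close>
  times the adjugate. As the adjugate is linear in dimension 2, the Poisson extensions are related
  in the same way.\<close>

lemma matrix_inv_cantor_matrix:
  assumes "1 \<le> q"
  shows "matrix_inv (cantor_matrix q n x) =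
    sym2 (q * (cantor_weight q n x * (cantor_shear n x)\<^sup>2 + dual_weight q n x))
      (- q * (cantor_weight q n x * cantor_shear n x)) (q * cantor_weight q n x)"
proof -
  have "cantor_weight q n x * (cantor_weight q n x * (cantor_shear n x)\<^sup>2 + dual_weight q n x)
    - (cantor_weight q n x * cantor_shear n x)\<^sup>2 = 1 / q"
    using weight_mult_dual[OF assms, of n x] by (simp add: power2_eq_square algebra_simps)
  from matrix_inv_sym2[OF this] show ?thesis
    using assms by (simp add: cantor_matrix_def mult.commute)
qed

lemma bounded_borel_moments:
  "1 \<le> q \<Longrightarrow> bounded_borel (\<lambda>x. cantor_weight q n x * cantor_shear n x)"
  "1 \<le> q \<Longrightarrow> bounded_borel (\<lambda>x. cantor_weight q n x * (cantor_shear n x)\<^sup>2 + dual_weight q n x)"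
  by (intro bounded_borel_intros bounded_borel_weight bounded_borel_shear bounded_borel_dual_weight;
      assumption)+

lemma matrix_weight_cantor_matrix:
  assumes "1 \<le> q" shows "matrix_weight (cantor_matrix q n)"
  unfolding matrix_weight_def
proof (intro conjI allI impI)
  show "cantor_matrix q n absolutely_integrable_on K" if "compact K" for K
    unfolding cantor_matrix_def[abs_def] using that assms
    by (intro absolutely_integrable_sym2 bounded_borel_moments bounded_borel_weight)
  show "pos_def_matrix (cantor_matrix q n x)" for x
    unfolding cantor_matrix_def
    using cantor_weight_pos[OF assms, of n x] dual_weight_bounds(1)[OF assms, of n x]
    by (intro pos_def_sym2) (auto simp: power2_eq_square algebra_simps)
qed

text \<open>The trace that bounds the squared norm is \<open>2 * q\<close> times the determinant of
  the Poisson extension of the weight. Up to \<open>1 / pi^2\<close> this determinant is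
  \<open>P * D + (P * S - R^2)\<close>, and both terms are at most \<open>8000^2\<close>.\<close>

lemma fat_A2_cantor_matrix:
  assumes q: "1 \<le> q" "real n \<le> q"
  shows "fat_A2_char (cantor_matrix q n) \<le> ennreal (256000000 * q)"
proof -
  define V where "V = (\<lambda>y. matrix_inv (cantor_matrix q n y))"
  let ?w = "cantor_weight q n" and ?g = "cantor_shear n" and ?d = "dual_weight q n"
  have W_eq: "cantor_matrix q n = (\<lambda>y. sym2 (?w y) (?w y * ?g y) (?w y * (?g y)\<^sup>2 + ?d y))"
    by (simp add: cantor_matrix_def fun_eq_iff)
  have V_eq: "V = (\<lambda>y. sym2 (q * (?w y * (?g y)\<^sup>2 + ?d y)) (- q * (?w y * ?g y)) (q * ?w y))"
    by (simp add: V_def matrix_inv_cantor_matrix q)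
  have "poisson_integrable (cantor_matrix q n) x t \<and> poisson_integrable V x t \<and>
    (onorm (\<lambda>v. (matrix_sqrt (poisson_ext (cantor_matrix q n) x t) ** matrix_sqrt (poisson_ext V x t)) *v v))\<^sup>2
      \<le> 256000000 * q" if t: "0 < t" for x t
  proof -
    define P where "P = poisson_integral ?w x t"
    define R where "R = poisson_integral (\<lambda>y. ?w y * ?g y) x t"
    define S where "S = poisson_integral (\<lambda>y. ?w y * (?g y)\<^sup>2) x t"
    define D where "D = poisson_integral ?d x t"
    note bb = bounded_borel_moments[OF q(1)] bounded_borel_intros bounded_borel_weight bounded_borel_shear
      bounded_borel_dual_weight[OF q(1)]
    have SD: "poisson_integral (\<lambda>y. ?w y * (?g y)\<^sup>2 + ?d y) x t = S + D"
      unfolding S_def D_def by (intro poisson_integral_add bb t)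
    have W: "poisson_integrable (cantor_matrix q n) x t"
      "poisson_ext (cantor_matrix q n) x t = sym2 (P / pi) (R / pi) ((S + D) / pi)"
      unfolding W_eq SD[symmetric] P_def R_def by (intro poisson_sym2 bb t)+
    have V: "poisson_integrable V x t"
      "poisson_ext V x t = sym2 (q * (S + D) / pi) (- q * R / pi) (q * P / pi)"
      unfolding V_eq SD[symmetric] P_def R_def
        poisson_integral_cmult[symmetric] by (intro poisson_sym2 bb t)+
    have spread: "poisson_integral (spread q n \<gamma>) x t = S - 2 * \<gamma> * R + \<gamma>\<^sup>2 * P" for \<gamma>
    proof -
      have "spread q n \<gamma> = (\<lambda>y. ?w y * (?g y)\<^sup>2 + ((- 2 * \<gamma>) * (?w y * ?g y) + \<gamma>\<^sup>2 * ?w y))"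
        by (auto simp: spread_def fun_eq_iff power2_eq_square algebra_simps)
      then show ?thesis
        by (simp only: poisson_integral_add poisson_integral_cmult bb t P_def R_def S_def)
    qed
    have "poisson_integral (\<lambda>y. 1 / q) x t \<le> P" unfolding P_def
      by (intro poisson_integral_mono bb t cantor_weight_ge q)
    moreover have "0 < pi * (1 / q)" using q(1) by simp
    ultimately have P: "0 < P" using t by (simp only: poisson_integral_const less_le_trans)
    have "1 / (q * 4 ^ n) \<le> ?d y" for y
      unfolding dual_weight_def using q(1) cantor_weight_pos[OF q(1), of n y] cantor_weight_le[OF q(1), of n y]
      by (intro divide_left_mono mult_left_mono) auto
    then have "poisson_integral (\<lambda>y. 1 / (q * 4 ^ n)) x t \<le> D" unfolding D_def
      by (intro poisson_integral_mono bb t)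
    moreover have "0 < pi * (1 / (q * 4 ^ n))" using q(1) by simp
    ultimately have D: "0 < D" using t by (simp only: poisson_integral_const less_le_trans)
    \<comment> \<open>The trial mean \<open>R / P\<close> yields the Cauchy-Schwarz inequality
      \<open>R^2 \<le> P * S\<close>.\<close>
    have "0 \<le> S - 2 * (R / P) * R + (R / P)\<^sup>2 * P"
      unfolding spread[symmetric] by (intro poisson_integral_nonneg spread_nonneg q t)
    then have "0 \<le> P * (S - 2 * (R / P) * R + (R / P)\<^sup>2 * P)" using P by simp
    also have "\<dots> = P * S - R\<^sup>2" using P by (simp add: power2_eq_square field_simps)
    finally have "R\<^sup>2 < P * S + P * D" using P D by (smt (verit) mult_pos_pos)
    then have det: "R\<^sup>2 < P * (S + D)" by (simp add: distrib_left)
    have SD0: "0 < S + D" using det P by (smt (verit) zero_le_power2 mult_nonneg_nonpos)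
    obtain m \<gamma> where m: "0 < m" "P \<le> 8000 * m" "D \<le> 8000 / m" "S - 2 * \<gamma> * R + \<gamma>\<^sup>2 * P \<le> 8000 / m"
      using poisson_controlled_all_scales[OF q t, of x] unfolding poisson_controlled_def spread
      by (auto simp: P_def D_def)
    have PD: "P * D \<le> 64000000"
      using mult_mono[OF m(2,3)] m(1) D by simp
    \<comment> \<open>The left side is \<open>P\<close> times the minimum of the spread integral
      over all trial means, so any particular \<open>\<gamma>\<close> bounds it.\<close>
    have "P * S - R\<^sup>2 \<le> P * (S - 2 * \<gamma> * R + \<gamma>\<^sup>2 * P)"
      using zero_le_power2[of "R - \<gamma> * P"] by (simp add: power2_eq_square algebra_simps)
    also have "\<dots> \<le> P * (8000 / m)" using m P by (intro mult_left_mono) auto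
    also have "\<dots> \<le> 8000 * m * (8000 / m)" using m by (intro mult_right_mono) auto
    also have "\<dots> = 64000000" using m by simp
    finally have PS: "P * S - R\<^sup>2 \<le> 64000000" .
    have "(onorm (\<lambda>v. (matrix_sqrt (poisson_ext (cantor_matrix q n) x t) ** matrix_sqrt (poisson_ext V x t)) *v v))\<^sup>2
      \<le> (P / pi) * (q * (S + D) / pi) + 2 * (R / pi) * (- q * R / pi) + ((S + D) / pi) * (q * P / pi)"
      unfolding W V
    proof (rule onorm_matrix_sqrt_mult_le)
      show "(R / pi)\<^sup>2 < P / pi * ((S + D) / pi)"
        using det by (simp add: power2_eq_square divide_strict_right_mono)
      have "q\<^sup>2 * R\<^sup>2 < q\<^sup>2 * (P * (S + D))" using det q(1) by (intro mult_strict_left_mono) auto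
      then have "q\<^sup>2 * R\<^sup>2 / pi\<^sup>2 < q\<^sup>2 * (P * (S + D)) / pi\<^sup>2" by (rule divide_strict_right_mono) simp
      then show "(- q * R / pi)\<^sup>2 < q * (S + D) / pi * (q * P / pi)"
        by (simp add: power2_eq_square mult_ac)
    qed (use P SD0 q(1) in auto)
    also have "\<dots> = 2 * q * (P * D + (P * S - R\<^sup>2)) / pi\<^sup>2"
      by (simp add: power2_eq_square field_simps)
    also have "\<dots> \<le> 2 * q * (P * D + (P * S - R\<^sup>2)) / 1"
    proof (rule divide_left_mono)
      have "1 \<le> pi" using pi_ge_two by linarith
      then show "1 \<le> pi\<^sup>2" by (simp add: one_le_power)
      show "0 \<le> 2 * q * (P * D + (P * S - R\<^sup>2))"
        using det q(1) by (intro mult_nonneg_nonneg) (auto simp: algebra_simps)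
    qed auto
    also have "\<dots> \<le> 2 * q * 128000000 / 1"
      using PD PS q(1) by (intro divide_right_mono mult_left_mono) auto
    finally show ?thesis using W(1) V(1) by simp
  qed
  then show ?thesis
    unfolding fat_A2_char_def Let_def V_def[symmetric]
    by (intro SUP_least) (auto intro: ennreal_leI)
qed

section \<open>The Hilbert transform of the test function\<close>

primrec cantor_set :: "nat \<Rightarrow> real set" where
  "cantor_set 0 = {0..1}"
| "cantor_set (Suc n) = {x. 8 * x - 2 \<in> cantor_set n \<or> 8 * x - 5 \<in> cantor_set n}"

text \<open>The exceptional points are listed by the recursion rather than as the true jump set, so that
  they pull back to the children.\<close>

primrec cantor_jumps :: "nat \<Rightarrow> real set" where
  "cantor_jumps 0 = {0, 1}"
| "cantor_jumps (Suc n) = {x. 8 * x - 2 \<in> {0, 1} \<union> cantor_jumps n \<or> 8 * x - 5 \<in> {0, 1} \<union> cantor_jumps n}"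

lemma cantor_set_subset: "cantor_set n \<subseteq> {0..1}"
  by (induction n) auto

text \<open>Reduces measurability and measure of the Cantor set to the facts about
  \<open>graft\<close>.\<close>

lemma indicator_cantor_set_Suc:
  "indicator (cantor_set (Suc n)) = graft 0 (indicator (cantor_set n)) (indicator (cantor_set n))"
  using cantor_set_subset[of n] by (fastforce simp: graft_def indicator_def fun_eq_iff)

lemma bounded_borel_cantor_indicator [simp]: "bounded_borel (indicator (cantor_set n))"
  by (induction n) (auto simp del: cantor_set.simps(2)
      simp: indicator_cantor_set_Suc intro: bounded_borel_graft)

lemma cantor_set_borel [measurable]: "cantor_set n \<in> sets borel"
  using bounded_borel_measurable[OF bounded_borel_cantor_indicator[of n]]
  by (simp add: borel_measurable_indicator_iff)

lemma unit_integral_cantor_indicator: "unit_integral (indicator (cantor_set n)) = 1 / 4 ^ n"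
proof (induction n)
  case 0
  show ?case by (simp add: unit_integral_def indicator_inter_arith[symmetric])
next
  case (Suc n)
  then show ?case
    by (simp del: cantor_set.simps(2) add: indicator_cantor_set_Suc unit_integral_graft)
qed

lemma emeasure_cantor_set: "emeasure lborel (cantor_set n) = ennreal (1 / 4 ^ n)"
proof -
  have "emeasure lborel (cantor_set n) \<le> emeasure lborel {0..1::real}"
    by (rule emeasure_mono[OF cantor_set_subset]) simp
  then have fin: "emeasure lborel (cantor_set n) \<noteq> \<infinity>" by (auto simp: top_unique)
  have eq: "indicator {0..1} y * indicator (cantor_set n) y = (indicator (cantor_set n) y :: real)" for y
    using cantor_set_subset[of n] by (auto simp: indicator_def)
  then have "measure lborel (cantor_set n) = 1 / 4 ^ n"
    using unit_integral_cantor_indicator[of n] unfolding unit_integral_def eq by simp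
  then show ?thesis using fin by (simp add: emeasure_eq_ennreal_measure)
qed

lemma cantor_weight_on_set: "x \<in> cantor_set n \<Longrightarrow> cantor_weight q n x = 4 ^ n"
proof (induction n arbitrary: x)
  case (Suc n)
  then consider "8 * x - 2 \<in> cantor_set n" | "8 * x - 5 \<in> cantor_set n" by auto
  then show ?case
  proof cases
    case 1
    then have "8 * x - 2 \<in> {0..1}" using cantor_set_subset by blast
    then show ?thesis using Suc.IH[OF 1] by (simp add: graft_def)
  next
    case 2
    then have "8 * x - 5 \<in> {0..1}" using cantor_set_subset by blast
    then show ?thesis using Suc.IH[OF 2] by (auto simp: graft_def)
  qed
qed simp

lemma finite_cantor_jumps: "finite (cantor_jumps n)"
proof (induction n)
  case (Suc n)
  have "inj (\<lambda>x::real. 8 * x - c)" for c by (rule injI) simp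
  then have "finite ((\<lambda>x. 8 * x - c) -` ({0, 1} \<union> cantor_jumps n))" for c
    using Suc by (intro finite_vimageI) auto
  moreover have "cantor_jumps (Suc n) = (\<lambda>x. 8 * x - 2) -` ({0, 1} \<union> cantor_jumps n) \<union>
      (\<lambda>x. 8 * x - 5) -` ({0, 1} \<union> cantor_jumps n)" by auto
  ultimately show ?case by (simp only: finite_Un)
qed simp

lemma eventually_nhds_unit_interval:
  assumes "z \<notin> {0, 1::real}" shows "\<forall>\<^sub>F t in nhds z. t \<in> {0..1} \<longleftrightarrow> z \<in> {0..1}"
proof (cases "z \<in> {0..1}")
  case True
  then have "\<forall>\<^sub>F t in nhds z. t \<in> {0<..<1}" using assms by (intro eventually_nhds_in_open) auto
  then show ?thesis by eventually_elim (use True in auto)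
next
  case False
  then have "\<forall>\<^sub>F t in nhds z. t \<in> - {0..1}" by (intro eventually_nhds_in_open) auto
  then show ?thesis by eventually_elim (use False in auto)
qed

text \<open>Local constancy makes the principal values at \<open>s\<close> exist and the commutator
  integrand vanish near \<open>s\<close>.\<close>

lemma eventually_locally_constant:
  assumes "s \<notin> cantor_jumps n"
  shows "\<forall>\<^sub>F t in nhds s. cantor_shear n t = cantor_shear n s \<and> (t \<in> cantor_set n \<longleftrightarrow> s \<in> cantor_set n)"
  using assms
proof (induction n arbitrary: s)
  case 0
  then show ?case using eventually_nhds_unit_interval[of s] by simp
next
  case (Suc n)
  have lim: "filterlim (\<lambda>t. 8 * t - c) (nhds (8 * s - c)) (nhds s)" for c :: real
    by (intro tendsto_intros filterlim_ident)
  have ev: "\<forall>\<^sub>F t in nhds s. (8 * t - c \<in> {0..1} \<longleftrightarrow> 8 * s - c \<in> {0..1}) \<and>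
      cantor_shear n (8 * t - c) = cantor_shear n (8 * s - c) \<and>
      (8 * t - c \<in> cantor_set n \<longleftrightarrow> 8 * s - c \<in> cantor_set n)"
    if "8 * s - c \<notin> {0, 1} \<union> cantor_jumps n" for c
  proof -
    have "8 * s - c \<notin> {0, 1}" "8 * s - c \<notin> cantor_jumps n" using that by auto
    from eventually_compose_filterlim[OF eventually_conj[OF eventually_nhds_unit_interval[OF this(1)]
        Suc.IH[OF this(2)]] lim]
    show ?thesis .
  qed
  have "\<forall>\<^sub>F t in nhds s. (8 * t - 2 \<in> {0..1} \<longleftrightarrow> 8 * s - 2 \<in> {0..1}) \<and>
      cantor_shear n (8 * t - 2) = cantor_shear n (8 * s - 2) \<and>
      (8 * t - 2 \<in> cantor_set n \<longleftrightarrow> 8 * s - 2 \<in> cantor_set n)"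
    "\<forall>\<^sub>F t in nhds s. (8 * t - 5 \<in> {0..1} \<longleftrightarrow> 8 * s - 5 \<in> {0..1}) \<and>
      cantor_shear n (8 * t - 5) = cantor_shear n (8 * s - 5) \<and>
      (8 * t - 5 \<in> cantor_set n \<longleftrightarrow> 8 * s - 5 \<in> cantor_set n)"
    using Suc.prems by (intro ev; simp)+
  then show ?case
    by eventually_elim (simp only: cantor_shear.simps graft_def cantor_set.simps mem_Collect_eq)
qed

section \<open>The commutator integral\<close>

text \<open>Up to \<open>1 / pi\<close>, the integrand of the commutator of
  \<open>cantor_shear n\<close> and the Hilbert transform, applied to the indicator of the Cantor
  set. At \<open>t = s\<close> division by zero gives the value 0.\<close>

definition shear_quotient :: "nat \<Rightarrow> real \<Rightarrow> real \<Rightarrow> real" where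
  "shear_quotient n s t = indicator (cantor_set n) t * ((cantor_shear n s - cantor_shear n t) / (s - t))"

lemma shear_measurable [measurable]: "cantor_shear n \<in> borel_measurable borel"
  using bounded_borel_shear[of n] by (simp add: bounded_borel_def)

text \<open>The quotient vanishes near \<open>s\<close> by local constancy, so it is bounded, and it
  is supported in the unit interval.\<close>

lemma integrable_shear_quotient:
  assumes "s \<notin> cantor_jumps n"
  shows "integrable lborel (shear_quotient n s)"
proof -
  obtain d where d: "0 < d" "\<And>t. dist t s < d \<Longrightarrow> cantor_shear n t = cantor_shear n s"
    using eventually_locally_constant[OF assms] unfolding eventually_nhds_metric by auto
  have "\<bar>shear_quotient n s t\<bar> \<le> 2 / d" for t
  proof (cases "dist t s < d")
    case True
    then show ?thesis using d(1) d(2)[OF True] by (simp add: shear_quotient_def)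
  next
    case False
    then have "\<bar>(cantor_shear n s - cantor_shear n t) / (s - t)\<bar> \<le> 2 / d"
      unfolding abs_divide using d(1) abs_cantor_shear_le[of n s] abs_cantor_shear_le[of n t]
      by (intro frac_le) (auto simp: dist_real_def)
    then show ?thesis using d(1) by (simp add: shear_quotient_def indicator_def)
  qed
  moreover have "shear_quotient n s \<in> borel_measurable borel"
    unfolding shear_quotient_def[abs_def] by measurable
  ultimately have "integrable lborel (\<lambda>t. indicator {0..1} t * shear_quotient n s t)"
    by (intro integrable_unit_interval bounded_borelI)
  moreover have "indicator {0..1} t * shear_quotient n s t = shear_quotient n s t" for t
    using cantor_set_subset[of n] by (auto simp: shear_quotient_def indicator_def)
  ultimately show ?thesis by simp
qed

text \<open>On the child containing \<open>s\<close> increments shrink by 4 and distances by 8, so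
  the quotient doubles; with the Jacobian 1/8 this gives the factor 1/4. The sibling adds at least
  \<open>1/8 * 4/3 / 4^n\<close>, which is \<open>2/3 / 4^(n+1)\<close>. Hence \<open>4^n\<close>
  times the lower bound grows by 2/3 per stage.\<close>

lemma shear_quotient_integral_ge:
  assumes "s \<in> cantor_set n" "s \<notin> cantor_jumps n"
  shows "2/3 * n / 4 ^ n \<le> (\<integral>t. shear_quotient n s t \<partial>lborel)"
  using assms
proof (induction n arbitrary: s)
  case 0
  then show ?case by (simp add: shear_quotient_def)
next
  case (Suc n)
  \<comment> \<open>\<open>c\<close> belongs to the child containing \<open>s\<close> and
    \<open>c'\<close> to its sibling; the sign \<open>e\<close> of the side of \<open>s\<close> lets
    one argument serve both cases.\<close>
  have step: ?case
    if c: "c = (2::real) \<and> c' = (5::real) \<and> e = -1 \<or> c = 5 \<and> c' = 2 \<and> e = (1::real)" and s: "8 * s - c \<in> cantor_set n"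
    for c c' e
  proof -
    \<comment> \<open>The quotient between \<open>s\<close> and the point of the sibling with
      coordinate \<open>y\<close>.\<close>
    define R where "R y = indicator (cantor_set n) y *
      ((e + (cantor_shear n (8 * s - c) - cantor_shear n y) / 4) / (s - (y + c') / 8))" for y
    have s01: "8 * s - c \<in> {0..1}" using s cantor_set_subset by blast
    have num: "2/3 \<le> e * (e + (cantor_shear n (8 * s - c) - cantor_shear n y) / 4)"
      "e * (e + (cantor_shear n (8 * s - c) - cantor_shear n y) / 4) \<le> 2" for y
    proof -
      have "\<bar>(cantor_shear n (8 * s - c) - cantor_shear n y) / 4\<bar> \<le> 1/3"
        using abs_triangle_ineq4[of "cantor_shear n (8 * s - c)" "cantor_shear n y"]
          abs_cantor_shear_le[of n "8 * s - c"] abs_cantor_shear_le[of n y] by simp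
      moreover have "2/3 \<le> e * (e + D) \<and> e * (e + D) \<le> 2" if "\<bar>D\<bar> \<le> 1/3" for D
        using c that by (auto simp: abs_le_iff)
      ultimately show "2/3 \<le> e * (e + (cantor_shear n (8 * s - c) - cantor_shear n y) / 4)"
        "e * (e + (cantor_shear n (8 * s - c) - cantor_shear n y) / 4) \<le> 2" by blast+
    qed
    \<comment> \<open>The gap between the children has length 1/4, and together they span an
      interval of length 1/2.\<close>
    have den: "1/4 \<le> e * (s - (y + c') / 8)" "e * (s - (y + c') / 8) \<le> 1/2" if "y \<in> {0..1}" for y
      using c s01 that by (auto simp: field_simps)
    have R: "4/3 * indicator (cantor_set n) y \<le> R y" "\<bar>R y\<bar> \<le> 8" for y
    proof -
      have "4/3 \<le> R y \<and> R y \<le> 8" if "y \<in> cantor_set n"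
      proof -
        have y: "y \<in> {0..1}" using that cantor_set_subset by blast
        define N where "N = e * (e + (cantor_shear n (8 * s - c) - cantor_shear n y) / 4)"
        define M where "M = e * (s - (y + c') / 8)"
        have N: "2/3 \<le> N" "N \<le> 2" and M: "1/4 \<le> M" "M \<le> 1/2"
          using num[of y] den[OF y] by (simp_all only: N_def M_def)
        have "R y = N / M"
          using that c by (auto simp: R_def N_def M_def)
        moreover have "(2/3) / (1/2) \<le> N / M" using N M by (intro frac_le) auto
        moreover have "N / M \<le> 2 / (1/4)" using N M by (intro frac_le) auto
        ultimately show ?thesis by simp
      qed
      moreover have "R y = 0" if "y \<notin> cantor_set n" using that by (simp add: R_def)
      ultimately show "4/3 * indicator (cantor_set n) y \<le> R y" "\<bar>R y\<bar> \<le> 8"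
        by (cases "y \<in> cantor_set n"; auto)+
    qed
    have bR: "bounded_borel R"
    proof (rule bounded_borelI[OF _ R(2)])
      show "R \<in> borel_measurable borel" unfolding R_def[abs_def] by measurable
    qed
    have split: "shear_quotient (Suc n) s t =
      2 * (indicator {0..1} (8 * t - c) * shear_quotient n (8 * s - c) (8 * t - c))
      + indicator {0..1} (8 * t - c') * R (8 * t - c')" for t
    proof -
      have gs: "cantor_shear (Suc n) s = cantor_shear n (8 * s - c) / 4 + e / 2"
        using c s01 by (auto simp: graft_def)
      consider (own) "8 * t - c \<in> {0..1}" | (other) "8 * t - c' \<in> {0..1}"
        | (none) "8 * t - c \<notin> {0..1}" "8 * t - c' \<notin> {0..1}" by blast
      then show ?thesis
      proof cases
        case own
        have gt: "cantor_shear (Suc n) t = cantor_shear n (8 * t - c) / 4 + e / 2"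
          using c own by (auto simp: graft_def)
        have out: "8 * t - c' \<notin> {0..1}" using c own by auto
        have mem: "t \<in> cantor_set (Suc n) \<longleftrightarrow> 8 * t - c \<in> cantor_set n"
          using c out cantor_set_subset[of n] by auto
        have "(cantor_shear (Suc n) s - cantor_shear (Suc n) t) / (s - t)
          = 2 * ((cantor_shear n (8 * s - c) - cantor_shear n (8 * t - c)) / (8 * s - c - (8 * t - c)))"
        proof (cases "s = t")
          case False
          then show ?thesis unfolding gs gt by (simp add: field_simps)
        qed simp
        moreover have "indicator {0..1} (8 * t - c) = (1::real)" "indicator {0..1} (8 * t - c') = (0::real)"
          "indicator (cantor_set (Suc n)) t = (indicator (cantor_set n) (8 * t - c) :: real)"
          using own out mem by (auto simp del: cantor_set.simps simp: indicator_def)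
        ultimately show ?thesis unfolding shear_quotient_def by simp
      next
        case other
        have gt: "cantor_shear (Suc n) t = cantor_shear n (8 * t - c') / 4 - e / 2"
          using c other by (auto simp: graft_def)
        have out: "8 * t - c \<notin> {0..1}" using c other by auto
        have mem: "t \<in> cantor_set (Suc n) \<longleftrightarrow> 8 * t - c' \<in> cantor_set n"
          using c out cantor_set_subset[of n] by auto
        have "(8 * t - c' + c') / 8 = t" by simp
        then have "R (8 * t - c') = indicator (cantor_set n) (8 * t - c') *
            ((e + (cantor_shear n (8 * s - c) - cantor_shear n (8 * t - c')) / 4) / (s - t))"
          unfolding R_def by simp
        moreover have "cantor_shear (Suc n) s - cantor_shear (Suc n) t =
            e + (cantor_shear n (8 * s - c) - cantor_shear n (8 * t - c')) / 4"
          unfolding gs gt by (simp add: field_simps)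
        moreover have "indicator {0..1} (8 * t - c) = (0::real)" "indicator {0..1} (8 * t - c') = (1::real)"
          "indicator (cantor_set (Suc n)) t = (indicator (cantor_set n) (8 * t - c') :: real)"
          using other out mem by (auto simp del: cantor_set.simps simp: indicator_def)
        ultimately show ?thesis unfolding shear_quotient_def by simp
      next
        case none
        then have "t \<notin> cantor_set (Suc n)" using c cantor_set_subset[of n] by auto
        then show ?thesis using none by (simp del: cantor_set.simps add: shear_quotient_def)
      qed
    qed
    have nj: "8 * s - c \<notin> cantor_jumps n" using Suc.prems(2) c by auto
    note i = integrable_shear_quotient[OF nj]
    have restrict: "indicator {0..1} t * shear_quotient n s' t = shear_quotient n s' t" for s' t
      using cantor_set_subset[of n] by (auto simp: shear_quotient_def indicator_def)
    have i1: "integrable lborel (\<lambda>t. indicator {0..1} (8 * t - c) * shear_quotient n (8 * s - c) (8 * t - c))"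
      by (rule integrable_child) (simp add: restrict i)
    have i2: "integrable lborel (\<lambda>t. indicator {0..1} (8 * t - c') * R (8 * t - c'))"
      by (rule integrable_child) (rule integrable_unit_interval[OF bR])
    have c1: "(\<integral>t. indicator {0..1} (8 * t - c) * shear_quotient n (8 * s - c) (8 * t - c) \<partial>lborel)
        = 1/8 * (\<integral>t. shear_quotient n (8 * s - c) t \<partial>lborel)"
      by (subst integral_child) (simp only: restrict)
    have c2: "(\<integral>t. indicator {0..1} (8 * t - c') * R (8 * t - c') \<partial>lborel) = 1/8 * unit_integral R"
      by (simp only: integral_child unit_integral_def)
    have "(\<integral>t. shear_quotient (Suc n) s t \<partial>lborel) =
      2 * (1/8 * (\<integral>t. shear_quotient n (8 * s - c) t \<partial>lborel)) + 1/8 * unit_integral R"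
      unfolding split using Bochner_Integration.integral_add[OF integrable_mult_right[OF i1, of 2] i2]
      by (simp only: integral_mult_right_zero c1 c2)
    moreover have "4/3 * (1 / 4 ^ n) \<le> unit_integral R"
      using unit_integral_mono[OF bounded_borel_mult[OF bounded_borel_const bounded_borel_cantor_indicator] bR R(1)]
      by (simp only: unit_integral_cmult unit_integral_cantor_indicator)
    moreover have "2/3 * n / 4 ^ n \<le> (\<integral>t. shear_quotient n (8 * s - c) t \<partial>lborel)"
      by (rule Suc.IH[OF s nj])
    ultimately have "2 * (1/8 * (2/3 * n / 4 ^ n)) + 1/8 * (4/3 * (1 / 4 ^ n)) \<le> (\<integral>t. shear_quotient (Suc n) s t \<partial>lborel)"
      by linarith
    then show ?thesis by (simp add: field_simps)
  qed
  show ?case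
    using Suc.prems(1) step[of 2 5 "-1"] step[of 5 2 1] by auto
qed

section \<open>Principal values of locally constant functions\<close>

text \<open>Reflection about \<open>s\<close> preserves Lebesgue measure, so the integral equals its
  own negative.\<close>

lemma integral_odd_eq_0:
  fixes F :: "real \<Rightarrow> real"
  assumes "\<And>t. F (2 * s - t) = - F t"
  shows "(\<integral>t. F t \<partial>lborel) = 0"
proof -
  have "(\<integral>t. F t \<partial>lborel) = (\<integral>t. F (2 * s + (-1) * t) \<partial>lborel)"
    using lborel_integral_real_affine[of "-1" F "2 * s"] by simp
  also have "\<dots> = - (\<integral>t. F t \<partial>lborel)" using assms by simp
  finally show ?thesis by simp
qed

lemma integrable_truncation:
  assumes F: "bounded_borel F" "\<And>t. t \<notin> {0..1} \<Longrightarrow> F t = 0" and e: "0 < \<epsilon>"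
  shows "integrable lborel (\<lambda>t. indicator {t. \<epsilon> < \<bar>s - t\<bar>} t * (F t / (s - t)))" (is "integrable lborel ?k")
proof -
  obtain B where B: "\<And>t. \<bar>F t\<bar> \<le> B" using F(1) by (auto simp: bounded_borel_def)
  have [measurable]: "F \<in> borel_measurable borel" using F(1) by (simp add: bounded_borel_def)
  have "\<bar>?k t\<bar> \<le> B / \<epsilon>" for t
  proof (cases "\<epsilon> < \<bar>s - t\<bar>")
    case True
    then show ?thesis using B[of t] order_trans[OF abs_ge_zero B[of t]] e by (auto simp: abs_divide intro!: frac_le)
  next
    case False
    then show ?thesis using order_trans[OF abs_ge_zero B[of t]] e by simp
  qed
  moreover have "?k \<in> borel_measurable borel" by measurable
  ultimately have "integrable lborel (\<lambda>t. indicator {0..1} t * ?k t)"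
    by (intro integrable_unit_interval bounded_borelI)
  moreover have "indicator {0..1} t * ?k t = ?k t" for t using F(2)[of t] by (cases "t \<in> {0..1}") auto
  ultimately show ?thesis by (simp only:)
qed

lemma hilbert_trunc_eq:
  assumes F: "bounded_borel F" "\<And>t. t \<notin> {0..1} \<Longrightarrow> F t = 0" and e: "0 < \<epsilon>"
  shows "set_integrable lebesgue {t. \<epsilon> < \<bar>s - t\<bar>} (\<lambda>t. F t / (s - t))"
    and "hilbert_trunc F \<epsilon> s = 1 / pi * (\<integral>t. indicator {t. \<epsilon> < \<bar>s - t\<bar>} t * (F t / (s - t)) \<partial>lborel)"
proof -
  note i = integrable_truncation[OF assms, of s]
  have "has_bochner_integral lebesgue (\<lambda>t. indicator {t. \<epsilon> < \<bar>s - t\<bar>} t * (F t / (s - t)))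
     (\<integral>t. indicator {t. \<epsilon> < \<bar>s - t\<bar>} t * (F t / (s - t)) \<partial>lborel)"
    by (intro has_bochner_integral_lebesgue has_bochner_integral_integrable i)
  then show "set_integrable lebesgue {t. \<epsilon> < \<bar>s - t\<bar>} (\<lambda>t. F t / (s - t))"
    "hilbert_trunc F \<epsilon> s = 1 / pi * (\<integral>t. indicator {t. \<epsilon> < \<bar>s - t\<bar>} t * (F t / (s - t)) \<partial>lborel)"
    by (simp_all add: set_integrable_def hilbert_trunc_def set_lebesgue_integral_def has_bochner_integral_iff)
qed

text \<open>Near \<open>s\<close> the integrand is a multiple of \<open>1 / (s - t)\<close>, whose
  integral over a symmetric annulus vanishes, so the truncations do not change for small
  \<open>\<epsilon>\<close>. The eventual equality lets both components of a vector be evaluated at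
  one common truncation.\<close>

lemma hilbert_locally_constant:
  assumes F: "bounded_borel F" "\<And>t. t \<notin> {0..1} \<Longrightarrow> F t = 0" and ev: "\<forall>\<^sub>F t in nhds s. F t = F s"
  shows "hilbert_pv_exists F s"
    and "\<forall>\<^sub>F \<epsilon> in at_right 0. hilbert_transform F s = hilbert_trunc F \<epsilon> s"
proof -
  have trunc: "integrable lborel (\<lambda>t. indicator {t. \<epsilon> < \<bar>s - t\<bar>} t * (F t / (s - t)))"
    "hilbert_trunc F \<epsilon> s = 1 / pi * (\<integral>t. indicator {t. \<epsilon> < \<bar>s - t\<bar>} t * (F t / (s - t)) \<partial>lborel)"
    "set_integrable lebesgue {t. \<epsilon> < \<bar>s - t\<bar>} (\<lambda>t. F t / (s - t))"
    if "0 < \<epsilon>" for \<epsilon>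
    using integrable_truncation[of F \<epsilon> s] hilbert_trunc_eq[of F \<epsilon> s] F that by blast+
  obtain d where d: "0 < d" "\<And>t. dist t s < d \<Longrightarrow> F t = F s"
    using ev unfolding eventually_nhds_metric by auto
  \<comment> \<open>Half of \<open>d\<close>, because the annulus below includes its outer
    boundary.\<close>
  define r where "r = d / 2"
  have r: "0 < r" using d(1) by (simp add: r_def)
  have Fr: "F t = F s" if "\<bar>s - t\<bar> \<le> r" for t
    using that d(1) by (intro d(2)) (simp add: dist_real_def r_def abs_minus_commute)
  have eq: "hilbert_trunc F \<epsilon> s = hilbert_trunc F r s" if e: "0 < \<epsilon>" "\<epsilon> < r" for \<epsilon>
  proof -
    define D where "D t = indicator {t. \<epsilon> < \<bar>s - t\<bar> \<and> \<bar>s - t\<bar> \<le> r} t * (F s / (s - t))" for t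
    have "(\<integral>t. D t \<partial>lborel) = 0"
    proof (rule integral_odd_eq_0)
      show "D (2 * s - t) = - D t" for t
      proof -
        have reflect: "s - (2 * s - t) = - (s - t)" by simp
        show ?thesis
          unfolding D_def indicator_def mem_Collect_eq reflect abs_minus_cancel divide_minus_right by simp
      qed
    qed
    moreover have "indicator {t. \<epsilon> < \<bar>s - t\<bar>} t * (F t / (s - t)) - indicator {t. r < \<bar>s - t\<bar>} t * (F t / (s - t)) = D t" for t
      using Fr[of t] e(2) by (auto simp: D_def indicator_def)
    ultimately have "(\<integral>t. indicator {t. \<epsilon> < \<bar>s - t\<bar>} t * (F t / (s - t)) \<partial>lborel)
        = (\<integral>t. indicator {t. r < \<bar>s - t\<bar>} t * (F t / (s - t)) \<partial>lborel)"
      using Bochner_Integration.integral_diff[OF trunc(1)[OF e(1)] trunc(1)[OF r]] by (simp only:)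
    then show ?thesis by (simp only: trunc(2)[OF e(1)] trunc(2)[OF r])
  qed
  have "\<forall>\<^sub>F \<epsilon> in at_right 0. \<epsilon> \<in> {0<..<r}" using r by (intro eventually_at_right_real)
  then have evr: "\<forall>\<^sub>F \<epsilon> in at_right 0. hilbert_trunc F \<epsilon> s = hilbert_trunc F r s"
    by eventually_elim (auto intro: eq)
  then have lim: "((\<lambda>\<epsilon>. hilbert_trunc F \<epsilon> s) \<longlongrightarrow> hilbert_trunc F r s) (at_right 0)"
    by (rule tendsto_eventually)
  then show "hilbert_pv_exists F s"
    unfolding hilbert_pv_exists_def using trunc(3) by blast
  have H: "hilbert_transform F s = hilbert_trunc F r s"
    unfolding hilbert_transform_def by (rule tendsto_Lim[OF _ lim]) simp
  from evr show "\<forall>\<^sub>F \<epsilon> in at_right 0. hilbert_transform F s = hilbert_trunc F \<epsilon> s"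
    by eventually_elim (simp add: H)
qed

section \<open>The test function and its Hilbert transform\<close>

definition test_function :: "nat \<Rightarrow> real \<Rightarrow> real^2" where
  "test_function n x = (\<chi> i. if i = 1 then - (indicator (cantor_set n) x * cantor_shear n x) else indicator (cantor_set n) x)"

lemma test_function_nth [simp]:
  "test_function n x $ 1 = - (indicator (cantor_set n) x * cantor_shear n x)"
  "test_function n x $ 2 = indicator (cantor_set n) x"
  by (simp_all add: test_function_def)

lemma bounded_borel_test_function: "bounded_borel (\<lambda>x. test_function n x $ i)"
proof -
  have "bounded_borel (\<lambda>x. (- 1) * (indicator (cantor_set n) x * cantor_shear n x))"
    by (intro bounded_borel_intros cantor_set_borel bounded_borel_shear)
  then show ?thesis using exhaust_2[of i] by auto
qed

text \<open>With \<open>f = (- g, 1)\<close> on \<open>E\<close>, the combination in the second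
  claim is \<open>g(s) H(1_E)(s) - H(g 1_E)(s)\<close>, that is, the commutator.\<close>

lemma test_function_hilbert:
  assumes s: "s \<notin> cantor_jumps n"
  shows "hilbert_pv_exists (\<lambda>t. test_function n t $ i) s"
    and "hilbert_transform_vec (test_function n) s $ 1 + cantor_shear n s * hilbert_transform_vec (test_function n) s $ 2
      = 1 / pi * (\<integral>t. shear_quotient n s t \<partial>lborel)"
proof -
  have off: "test_function n t $ i = 0" if "t \<notin> {0..1}" for t i
    using that cantor_set_subset[of n] exhaust_2[of i] by (auto simp: indicator_def)
  note lc = eventually_locally_constant[OF s]
  have ev: "\<forall>\<^sub>F t in nhds s. test_function n t $ i = test_function n s $ i" for i
    using lc by eventually_elim (simp add: test_function_def indicator_def)
  have H: "hilbert_pv_exists (\<lambda>t. test_function n t $ i) s"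
    "\<forall>\<^sub>F \<epsilon> in at_right 0. hilbert_transform (\<lambda>t. test_function n t $ i) s = hilbert_trunc (\<lambda>t. test_function n t $ i) \<epsilon> s" for i
    using hilbert_locally_constant[OF bounded_borel_test_function _ ev] off by blast+
  show "hilbert_pv_exists (\<lambda>t. test_function n t $ i) s" by (rule H(1))
  obtain d where d: "0 < d" "\<And>t. dist t s < d \<Longrightarrow> cantor_shear n t = cantor_shear n s"
    using lc unfolding eventually_nhds_metric by auto
  have "\<forall>\<^sub>F \<epsilon> in at_right 0. \<epsilon> \<in> {0<..<d}" using d(1) by (intro eventually_at_right_real)
  with H(2)[of 1] H(2)[of 2] have "\<forall>\<^sub>F \<epsilon> in at_right 0. \<epsilon> \<in> {0<..<d} \<and>
      (\<forall>i. hilbert_transform (\<lambda>t. test_function n t $ i) s = hilbert_trunc (\<lambda>t. test_function n t $ i) \<epsilon> s)"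
    by eventually_elim (auto simp: forall_2)
  from eventually_happens'[OF _ this] obtain \<epsilon> where "\<epsilon> \<in> {0<..<d}"
    and e3: "\<forall>i. hilbert_transform (\<lambda>t. test_function n t $ i) s = hilbert_trunc (\<lambda>t. test_function n t $ i) \<epsilon> s"
    using trivial_limit_at_right_real by blast
  then have e: "0 < \<epsilon>" "\<epsilon> < d" by auto
  define k where "k i t = indicator {t. \<epsilon> < \<bar>s - t\<bar>} t * (test_function n t $ i / (s - t))" for i t
  have i: "integrable lborel (k i)" for i
    unfolding k_def[abs_def] by (rule integrable_truncation[OF bounded_borel_test_function _ e(1)]) (rule off)
  have h: "hilbert_transform_vec (test_function n) s $ i = 1 / pi * (\<integral>t. k i t \<partial>lborel)" for i
  proof -
    have "hilbert_trunc (\<lambda>t. test_function n t $ i) \<epsilon> s = 1 / pi * (\<integral>t. k i t \<partial>lborel)"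
      unfolding k_def by (rule hilbert_trunc_eq(2)[OF bounded_borel_test_function _ e(1)]) (rule off)
    then show ?thesis using e3 by (simp add: hilbert_transform_vec_def)
  qed
  \<comment> \<open>Truncation at \<open>\<epsilon> < d\<close> loses nothing here: the removed
    points have the same shear as \<open>s\<close>, so the quotient is 0 there.\<close>
  have "k 1 t + cantor_shear n s * k 2 t = shear_quotient n s t" for t
  proof (cases "\<epsilon> < \<bar>s - t\<bar>")
    case True
    then show ?thesis by (simp add: k_def shear_quotient_def right_diff_distrib diff_divide_distrib mult_ac)
  next
    case False
    then have "cantor_shear n t = cantor_shear n s" using e(2) by (intro d) (simp add: dist_real_def abs_minus_commute)
    then show ?thesis using False by (simp add: k_def shear_quotient_def)
  qed
  then have "(\<integral>t. shear_quotient n s t \<partial>lborel) = (\<integral>t. k 1 t \<partial>lborel) + cantor_shear n s * (\<integral>t. k 2 t \<partial>lborel)"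
    using Bochner_Integration.integral_add[OF i[of 1] integrable_mult_right[OF i[of 2], of "cantor_shear n s"]]
    by simp
  then show "hilbert_transform_vec (test_function n) s $ 1 + cantor_shear n s * hilbert_transform_vec (test_function n) s $ 2
      = 1 / pi * (\<integral>t. shear_quotient n s t \<partial>lborel)"
    unfolding h by (simp add: algebra_simps)
qed

section \<open>Weighted norms of the test function and of its Hilbert transform\<close>

lemma L2_weight_norm_eq:
  assumes "(\<integral>\<^sup>+ x. ennreal ((W x *v f x) \<bullet> f x) \<partial>lebesgue) = ennreal I" "0 \<le> I"
  shows "L2_weight_norm W f = ennreal (sqrt I)"
  unfolding L2_weight_norm_def assms(1) using assms(2) by simp

lemma L2_weight_norm_ge:
  assumes "ennreal I \<le> (\<integral>\<^sup>+ x. ennreal ((W x *v f x) \<bullet> f x) \<partial>lebesgue)" "0 \<le> I"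
  shows "ennreal (sqrt I) \<le> L2_weight_norm W f"
proof (cases "(\<integral>\<^sup>+ x. ennreal ((W x *v f x) \<bullet> f x) \<partial>lebesgue) = \<infinity>")
  case True
  then show ?thesis by (simp add: L2_weight_norm_def)
next
  case False
  then have "I \<le> enn2real (\<integral>\<^sup>+ x. ennreal ((W x *v f x) \<bullet> f x) \<partial>lebesgue)"
    using assms enn2real_mono[OF assms(1)] by (simp add: less_top)
  then show ?thesis using False unfolding L2_weight_norm_def by (simp add: ennreal_leI)
qed

lemma nn_integral_cantor_const:
  assumes "0 \<le> a"
  shows "(\<integral>\<^sup>+ x. ennreal (a * indicator (cantor_set n) x) \<partial>lebesgue) = ennreal (a / 4 ^ n)"
proof -
  have "(\<integral>\<^sup>+ x. ennreal (a * indicator (cantor_set n) x) \<partial>lebesgue)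
    = (\<integral>\<^sup>+ x. ennreal a * indicator (cantor_set n) x \<partial>lborel)"
    unfolding nn_integral_completion by (intro nn_integral_cong) (simp add: indicator_def)
  also have "\<dots> = ennreal a * emeasure lborel (cantor_set n)"
    by (simp add: nn_integral_cmult_indicator)
  also have "\<dots> = ennreal (a / 4 ^ n)"
    unfolding emeasure_cantor_set using assms by (simp add: ennreal_mult[symmetric])
  finally show ?thesis .
qed

text \<open>The first square vanishes identically, which leaves \<open>1 / (q * 4^n)\<close> on a
  set of measure \<open>1 / 4^n\<close>.\<close>

lemma test_function_norm:
  assumes "1 \<le> q"
  shows "L2_weight_norm (cantor_matrix q n) (test_function n) = ennreal (1 / (4 ^ n * sqrt q))"
proof -
  have eq: "(cantor_matrix q n x *v test_function n x) \<bullet> test_function n x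
      = 1 / (q * 4 ^ n) * indicator (cantor_set n) x" for x
    unfolding cantor_matrix_form by (auto simp: indicator_def dual_weight_def cantor_weight_on_set)
  have "L2_weight_norm (cantor_matrix q n) (test_function n) = ennreal (sqrt (1 / (q * 4 ^ n) / 4 ^ n))"
  proof (rule L2_weight_norm_eq)
    show "(\<integral>\<^sup>+ x. ennreal ((cantor_matrix q n x *v test_function n x) \<bullet> test_function n x) \<partial>lebesgue)
        = ennreal (1 / (q * 4 ^ n) / 4 ^ n)"
      unfolding eq using assms by (intro nn_integral_cantor_const) simp
  qed (use assms in simp)
  also have "sqrt (1 / (q * 4 ^ n) / 4 ^ n) = 1 / (4 ^ n * sqrt q)"
    by (simp add: real_sqrt_divide real_sqrt_mult field_simps)
  finally show ?thesis .
qed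

lemma AE_not_cantor_jumps: "AE s in lebesgue. s \<notin> cantor_jumps n"
  using negligible_finite[OF finite_cantor_jumps[of n]] by (simp add: AE_not_in negligible_iff_null_sets)

text \<open>Only the first square and only the Cantor set are retained. There the weight
  \<open>4^n\<close> cancels the measure \<open>1 / 4^n\<close>, and the pointwise lower bound
  \<open>K\<close> for the commutator remains.\<close>

lemma hilbert_test_function_norm:
  assumes "1 \<le> q"
  shows "ennreal (2 * real n / (3 * pi * 4 ^ n))
    \<le> L2_weight_norm (cantor_matrix q n) (hilbert_transform_vec (test_function n))"
proof -
  define K where "K = 2/3 * n / 4 ^ n / pi"
  have K: "0 \<le> K" by (simp add: K_def)
  have "AE s in lebesgue. ennreal (4 ^ n * K\<^sup>2 * indicator (cantor_set n) s)
      \<le> ennreal ((cantor_matrix q n s *v hilbert_transform_vec (test_function n) s) \<bullet> hilbert_transform_vec (test_function n) s)"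
    using AE_not_cantor_jumps[of n]
  proof eventually_elim
    case (elim s)
    let ?H = "hilbert_transform_vec (test_function n) s"
    have d: "0 \<le> dual_weight q n s" and w: "0 \<le> cantor_weight q n s"
      using dual_weight_bounds(1)[OF assms, of n s] cantor_weight_pos[OF assms, of n s] by auto
    show ?case
    proof (cases "s \<in> cantor_set n")
      case True
      have "K \<le> 1 / pi * (\<integral>t. shear_quotient n s t \<partial>lborel)"
        using divide_right_mono[OF shear_quotient_integral_ge[OF True elim], of pi] by (simp add: K_def)
      then have "K\<^sup>2 \<le> (?H $ 1 + cantor_shear n s * ?H $ 2)\<^sup>2"
        unfolding test_function_hilbert(2)[OF elim] using K by (intro power_mono)
      then have "4 ^ n * K\<^sup>2 \<le> cantor_weight q n s * (?H $ 1 + cantor_shear n s * ?H $ 2)\<^sup>2"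
        unfolding cantor_weight_on_set[OF True] by (intro mult_left_mono) auto
      then show ?thesis using d True unfolding cantor_matrix_form
        by (intro ennreal_leI) (simp add: add_increasing2)
    qed simp
  qed
  then have "(\<integral>\<^sup>+ s. ennreal (4 ^ n * K\<^sup>2 * indicator (cantor_set n) s) \<partial>lebesgue)
    \<le> (\<integral>\<^sup>+ s. ennreal ((cantor_matrix q n s *v hilbert_transform_vec (test_function n) s)
        \<bullet> hilbert_transform_vec (test_function n) s) \<partial>lebesgue)"
    by (rule nn_integral_mono_AE)
  then have "ennreal (4 ^ n * K\<^sup>2 / 4 ^ n)
    \<le> (\<integral>\<^sup>+ s. ennreal ((cantor_matrix q n s *v hilbert_transform_vec (test_function n) s)
        \<bullet> hilbert_transform_vec (test_function n) s) \<partial>lebesgue)"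
    by (subst (asm) nn_integral_cantor_const) auto
  then have "ennreal (sqrt (4 ^ n * K\<^sup>2 / 4 ^ n))
    \<le> L2_weight_norm (cantor_matrix q n) (hilbert_transform_vec (test_function n))"
    by (rule L2_weight_norm_ge) simp
  also have "sqrt (4 ^ n * K\<^sup>2 / 4 ^ n) = 2 * real n / (3 * pi * 4 ^ n)"
    using K by (simp add: K_def mult_ac)
  finally show ?thesis .
qed

lemma test_function_measurable: "test_function n \<in> borel_measurable lebesgue"
proof -
  have "test_function n = (\<lambda>x. test_function n x $ 1 *\<^sub>R axis 1 1 + test_function n x $ 2 *\<^sub>R axis 2 1)"
    by (auto simp: fun_eq_iff vec_eq_iff forall_2 axis_def)
  moreover have [measurable]: "(\<lambda>x. test_function n x $ i) \<in> borel_measurable borel" for i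
    by (rule bounded_borel_measurable[OF bounded_borel_test_function])
  have "(\<lambda>x. test_function n x $ 1 *\<^sub>R axis 1 1 + test_function n x $ 2 *\<^sub>R axis 2 1 :: real^2) \<in> borel_measurable borel"
    by measurable
  ultimately have "test_function n \<in> borel_measurable lborel" by simp
  then show ?thesis by (rule measurable_completion)
qed

section \<open>Choice of \<open>q\<close> and \<open>n\<close> in terms of \<open>Q\<close>\<close>

theorem theorem2p1:
  shows "\<exists>c::real. c > 0 \<and> (\<forall>\<^sub>F Q::real in at_top.
    \<exists>(W :: real \<Rightarrow> real^2^2) (f :: real \<Rightarrow> real^2).
      matrix_weight W \<and> fat_A2_char W \<le> ennreal Q \<and>
      in_L2_weight W f \<and> \<not> (AE x in lebesgue. f x = 0) \<and>
      (AE s in lebesgue. \<forall>i. hilbert_pv_exists (\<lambda>t. f t $ i) s) \<and>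
      L2_weight_norm W (hilbert_transform_vec f) \<ge> ennreal (c * Q powr (3/2)) * L2_weight_norm W f)"
\<comment> \<open>The characteristic is at most \<open>16000^2 * q\<close>, and
  \<open>Q = 16000^2 * q\<close> makes \<open>Q powr (3/2)\<close> equal to
  \<open>16000^3 * q * sqrt q\<close>. The ratio of the norms is at least
  \<open>2 * n * sqrt q / (3 * pi)\<close>, where \<open>2 * n\<close> is at least \<open>q\<close>
  and \<open>3 * pi\<close> is below 12.\<close>
proof (intro exI[of _ "1 / (12 * 16000 ^ 3)"] conjI)
  show "\<forall>\<^sub>F Q::real in at_top.
    \<exists>(W :: real \<Rightarrow> real^2^2) (f :: real \<Rightarrow> real^2).
      matrix_weight W \<and> fat_A2_char W \<le> ennreal Q \<and>
      in_L2_weight W f \<and> \<not> (AE x in lebesgue. f x = 0) \<and>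
      (AE s in lebesgue. \<forall>i. hilbert_pv_exists (\<lambda>t. f t $ i) s) \<and>
      L2_weight_norm W (hilbert_transform_vec f) \<ge> ennreal (1 / (12 * 16000 ^ 3) * Q powr (3/2)) * L2_weight_norm W f"
    using eventually_ge_at_top[of 256000000]
  proof eventually_elim
    case (elim Q)
    define q where "q = Q / 256000000"
    \<comment> \<open>The largest number of stages with \<open>n \<le> q\<close>; it is at least
      \<open>q / 2\<close> because the floor of \<open>q\<close> is at least 1.\<close>
    define n where "n = nat \<lfloor>q\<rfloor>"
    have q: "1 \<le> q" "Q = 256000000 * q" using elim by (auto simp: q_def)
    have "real n = \<lfloor>q\<rfloor>" "1 \<le> \<lfloor>q\<rfloor>" using q(1) by (auto simp: n_def)
    then have n: "real n \<le> q" "q \<le> 2 * real n" by linarith+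
    let ?W = "cantor_matrix q n" and ?f = "test_function n"
    have norm: "L2_weight_norm ?W ?f = ennreal (1 / (4 ^ n * sqrt q))" by (rule test_function_norm[OF q(1)])
    have nonzero: "\<not> (AE x in lebesgue. ?f x = 0)"
    proof
      assume "AE x in lebesgue. ?f x = 0"
      then have "AE x in lebesgue. ennreal ((?W x *v ?f x) \<bullet> ?f x) = 0"
        by eventually_elim simp
      then have "(\<integral>\<^sup>+ x. ennreal ((?W x *v ?f x) \<bullet> ?f x) \<partial>lebesgue) = (\<integral>\<^sup>+ (x::real). 0 \<partial>lebesgue)"
        by (rule nn_integral_cong_AE)
      then have "L2_weight_norm ?W ?f = 0" by (simp add: L2_weight_norm_def)
      then show False using q(1) by (simp add: norm)
    qed
    have "Q powr (3/2) = Q powr 1 * Q powr (1/2)" by (simp only: powr_add[symmetric]) simp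
    also have "\<dots> = 16000 ^ 3 * (q * sqrt q)"
      using q real_sqrt_mult[of "16000\<^sup>2" q] by (simp add: powr_half_sqrt)
    finally have Q: "1 / (12 * 16000 ^ 3) * Q powr (3/2) = q * sqrt q / 12" by simp
    have "ennreal (q * sqrt q / 12) * ennreal (1 / (4 ^ n * sqrt q)) = ennreal (q / (12 * 4 ^ n))"
      using q(1) by (simp add: ennreal_mult[symmetric])
    also have "\<dots> \<le> ennreal (2 * real n / (3 * pi * 4 ^ n))"
    proof (rule ennreal_leI)
      have "q / (12 * 4 ^ n) \<le> 2 * real n / (12 * 4 ^ n)" using n by (intro divide_right_mono) auto
      also have "\<dots> \<le> 2 * real n / (3 * pi * 4 ^ n)"
        using pi_less_4 by (intro divide_left_mono mult_right_mono) auto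
      finally show "q / (12 * 4 ^ n) \<le> 2 * real n / (3 * pi * 4 ^ n)" .
    qed
    also have "\<dots> \<le> L2_weight_norm ?W (hilbert_transform_vec ?f)"
      by (rule hilbert_test_function_norm[OF q(1)])
    finally have "ennreal (1 / (12 * 16000 ^ 3) * Q powr (3/2)) * L2_weight_norm ?W ?f
        \<le> L2_weight_norm ?W (hilbert_transform_vec ?f)" unfolding norm Q .
    moreover have "fat_A2_char ?W \<le> ennreal Q" using fat_A2_cantor_matrix[OF q(1) n(1)] q(2) by simp
    moreover have "in_L2_weight ?W ?f"
      by (simp add: in_L2_weight_def test_function_measurable norm)
    moreover have "AE s in lebesgue. \<forall>i. hilbert_pv_exists (\<lambda>t. ?f t $ i) s"
      using AE_not_cantor_jumps[of n] by eventually_elim (simp add: test_function_hilbert(1))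
    ultimately show ?case
      using matrix_weight_cantor_matrix[OF q(1), of n] nonzero by blast
  qed
qed simp

end
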